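(* Let $0<\alpha<n$, $1<p<\infty$ and $\frac1q=\frac1p-\frac{\alpha}{n}$. Let $A\in\mathbb{R}^{n\times n}$ be an invertible matrix such that $A^k=I$ for some $k\in\mathbb{N}$. Then $$\mathcal{A}_{A,p,q}=\{w\in\mathcal{A}_{p,q}:\ w(Ax)\lesssim w(x)\ \text{for a.e. }x\in\mathbb{R}^n\}.$$ Moreover, $w\in\mathcal{A}_{A,p,q}$ if and only if $M_{\alpha,A^{-1}}$ is bounded from $L^p(w^p)$ into $L^q(w^q)$, i.e. if and only if there is a constant $C$ such that $\left(\int_{\mathbb{R}^n}(M_{\alpha,A^{-1}}f)^q\,w^q\,dx\right)^{1/q}\le C\left(\int_{\mathbb{R}^n}|f|^p\,w^p\,dx\right)^{1/p}$ for all $f\in L^p(w^p)$.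
   Context: A weight is a locally integrable function $w$ on $\mathbb{R}^n$ with $0<w<\infty$ a.e.; $p'=p/(p-1)$. Cubes $Q$ have sides parallel to the axes. For an invertible matrix $A$, $w_A(x)=w(Ax)$ and $M_{\alpha,A^{-1}}f(x)=M_\alpha f(A^{-1}x)=\sup_{Q\ni A^{-1}x}\frac1{|Q|^{1-\alpha/n}}\int_Q|f(y)|\,dy$. For $1\le r<\infty$, $\|f\|_{r,Q}=\left(\frac1{|Q|}\int_Q|f|^r\right)^{1/r}$. For $1<p<\infty$, $0<\alpha<n$ and $\frac1q=\frac1p-\frac{\alpha}{n}$, a weight $w$ belongs to $\mathcal{A}_{A,p,q}$ if $[w]_{\mathcal{A}_{A,p,q}}=\sup_Q\|w_A^{1/q}\|_{q,Q}\,\|w^{-1/p}\|_{p',Q}<\infty$, the supremum being over all cubes $Q$; $\mathcal{A}_{p,q}$ denotes the class without matrix, $\mathcal{A}_{p,q}=\mathcal{A}_{I,p,q}$. The notation $w(Ax)\lesssim w(x)$ a.e. means that there is a constant $C>0$ with $w(Ax)\le C\,w(x)$ for a.e. $x$.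
   Formalization: The class constant is taken as sup_Q ||w_A||_{q,Q} ||w^{-1}||_{p',Q} (also for A=I) instead of sup_Q ||w_A^{1/q}||_{q,Q} ||w^{-1/p}||_{p',Q}, with which both claims are false; 1/q>0 and k≥1 are made explicit. *)

theory Defs
  imports "HOL-Analysis.Analysis"
begin

text \<open>
  Functions on \<open>\<real>\<^sup>n\<close> have type \<open>real ^ 'n \<Rightarrow> real\<close>, so finiteness is built into the type and
  only positivity of a weight is required almost everywhere. Measurability is Lebesgue
  measurability. Every norm, average and supremum that may be infinite is an extended
  nonnegative real.
\<close>

definition weight :: "(real ^ 'n \<Rightarrow> real) \<Rightarrow> bool" where
  "weight w \<longleftrightarrow>
     w \<in> borel_measurable lebesgue \<and>
     (\<forall>K. compact K \<longrightarrow> set_integrable lebesgue K w) \<and>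
     (AE x in lebesgue. 0 < w x)"

definition cubes :: "(real ^ 'n) set set" where
  "cubes = {cbox a (a + (\<chi> i. l)) | a l. 0 < l}"

text \<open>Only used with exponents \<open>r > 0\<close>; it satisfies \<open>0\<^sup>r = 0\<close> and \<open>\<infinity>\<^sup>r = \<infinity>\<close>.\<close>

definition epowr :: "ennreal \<Rightarrow> real \<Rightarrow> ennreal" where
  "epowr x r = (if x = \<infinity> then \<infinity> else ennreal (enn2real x powr r))"

definition avg_norm :: "real \<Rightarrow> (real ^ 'n) set \<Rightarrow> (real ^ 'n \<Rightarrow> real) \<Rightarrow> ennreal" where
  "avg_norm r Q f =
     epowr ((\<integral>\<^sup>+x\<in>Q. ennreal (\<bar>f x\<bar> powr r) \<partial>lebesgue) / emeasure lebesgue Q) (1 / r)"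

definition conj_exp :: "real \<Rightarrow> real" where
  "conj_exp p = p / (p - 1)"

text \<open>
  The normalisation is the one attached to the measures \<open>w\<^sup>p dx\<close> and \<open>w\<^sup>q dx\<close>, namely
  \<open>sup\<^sub>Q (avg\<^sub>Q w(A x)\<^sup>q)\<^bsup>1/q\<^esup> (avg\<^sub>Q w\<^bsup>-p'\<^esup>)\<^bsup>1/p'\<^esup>\<close>. It is invariant under \<open>w \<mapsto> c w\<close>, and
  for \<open>A = I\<close> it is the Muckenhoupt--Wheeden condition. The powers \<open>w\<^sub>A\<^bsup>1/q\<^esup>\<close> and
  \<open>w\<^bsup>-1/p\<^esup>\<close> inside the two norms would belong to the boundedness from \<open>L\<^sup>p(w)\<close> to \<open>L\<^sup>q(w)\<close>
  and, since \<open>p < q\<close>, do not yield \<open>w(A x) \<le> C w(x)\<close>.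
\<close>

definition Apq_const :: "real ^ 'n ^ 'n \<Rightarrow> real \<Rightarrow> real \<Rightarrow> (real ^ 'n \<Rightarrow> real) \<Rightarrow> ennreal" where
  "Apq_const A p q w =
     (SUP Q\<in>cubes. avg_norm q Q (\<lambda>x. w (A *v x)) * avg_norm (conj_exp p) Q (\<lambda>x. inverse (w x)))"

definition Apq_class_mat :: "real ^ 'n ^ 'n \<Rightarrow> real \<Rightarrow> real \<Rightarrow> (real ^ 'n \<Rightarrow> real) set" where
  "Apq_class_mat A p q = {w. weight w \<and> Apq_const A p q w < \<infinity>}"

definition Apq_class :: "real \<Rightarrow> real \<Rightarrow> (real ^ 'n \<Rightarrow> real) set" where
  "Apq_class p q = Apq_class_mat (mat 1) p q"

definition frac_maximal :: "real \<Rightarrow> (real ^ 'n \<Rightarrow> real) \<Rightarrow> real ^ 'n \<Rightarrow> ennreal" where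
  "frac_maximal \<alpha> f x =
     (SUP Q\<in>{Q \<in> cubes. x \<in> Q}.
        (\<integral>\<^sup>+y\<in>Q. ennreal \<bar>f y\<bar> \<partial>lebesgue) / ennreal (measure lebesgue Q powr (1 - \<alpha> / real CARD('n))))"

definition frac_maximal_mat ::
    "real \<Rightarrow> real ^ 'n ^ 'n \<Rightarrow> (real ^ 'n \<Rightarrow> real) \<Rightarrow> real ^ 'n \<Rightarrow> ennreal" where
  "frac_maximal_mat \<alpha> B f x = frac_maximal \<alpha> f (B *v x)"

text \<open>The norm of \<open>L\<^sup>r(w\<^sup>r)\<close>, for functions with values in \<open>[0, \<infinity>]\<close>.\<close>

definition wnorm :: "real \<Rightarrow> (real ^ 'n \<Rightarrow> real) \<Rightarrow> (real ^ 'n \<Rightarrow> ennreal) \<Rightarrow> ennreal" where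
  "wnorm r w g = epowr (\<integral>\<^sup>+x. epowr (g x) r * ennreal (w x powr r) \<partial>lebesgue) (1 / r)"

definition weighted_Lp :: "real \<Rightarrow> (real ^ 'n \<Rightarrow> real) \<Rightarrow> (real ^ 'n \<Rightarrow> real) set" where
  "weighted_Lp p w =
     {f \<in> borel_measurable lebesgue. wnorm p w (\<lambda>x. ennreal \<bar>f x\<bar>) < \<infinity>}"

definition bounded_weighted ::
    "((real ^ 'n \<Rightarrow> real) \<Rightarrow> real ^ 'n \<Rightarrow> ennreal) \<Rightarrow> real \<Rightarrow> real \<Rightarrow> (real ^ 'n \<Rightarrow> real) \<Rightarrow> bool" where
  "bounded_weighted T p q w \<longleftrightarrow>
     (\<exists>C::real. \<forall>f\<in>weighted_Lp p w.
        wnorm q w (T f) \<le> ennreal C * wnorm p w (\<lambda>x. ennreal \<bar>f x\<bar>))"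

primrec matrix_power :: "real ^ 'n ^ 'n \<Rightarrow> nat \<Rightarrow> real ^ 'n ^ 'n" where
  "matrix_power A 0 = mat 1"
| "matrix_power A (Suc k) = A ** matrix_power A k"

end

theory Submission
  imports Defs
begin

text \<open>
  If \<open>w(A x) > s\<close> and \<open>w(x) < t\<close> on a set of positive measure, that set fills half of some cube, on
  which the \<open>A\<close>-weighted constant is at least a fixed multiple of \<open>s/t\<close>; hence finiteness of the
  constant forces \<open>w(A x) \<lesssim> w(x)\<close> a.e. Iterating along \<open>A\<^sup>k = I\<close> gives the reverse inequality, and
  the two classes coincide. Necessity of the condition for boundedness is tested on truncations of
  \<open>w\<^bsup>-p'\<^esup> 1\<^sub>Q\<close>.

  For sufficiency put \<open>\<mu> = w\<^sup>q dx\<close>, \<open>\<sigma> = w\<^bsup>-p'\<^esup> dx\<close>, \<open>g = f w\<^bsup>p'\<^esup>\<close>. As in Lerner's proof of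
  Muckenhoupt's theorem, the condition on \<open>w\<close> bounds, on dyadic cubes, a power of the fractional
  average of \<open>f\<close> by the \<open>\<mu>\<close>-average of \<open>(M\<^sub>\<sigma> g)\<^sup>\<theta> w\<^bsup>-q\<^esup>\<close>, so that \<open>M\<^sub>\<alpha>\<close> is controlled by the dyadic
  maximal operator of \<open>\<mu>\<close> composed with that of \<open>\<sigma>\<close>. Both are bounded whatever the measure, so
  neither reverse Hoelder inequalities nor doubling are needed. Translated grids pass from dyadic
  cubes to all cubes.
\<close>

text \<open>The exponents come from one requirement. Put s = 1 - \<alpha>/n, which equals 1/q +
  1/p', the total volume exponent of the weight condition. If p = q, the power of the average in
  Lerner's argument is p - 1; here it is e = q/(p' s), and \<theta> = p e/q. Then e (p' s) = q and
  \<theta> (p' s) = p, while w^(-q) raised to the power p' s turns \<mu> into \<sigma>: the L^(p'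
  s)(\<mu>) norm of (M_\<sigma> g)^\<theta> w^(-q) is a power of the L^p(\<sigma>) norm of
  M_\<sigma> g. Since p < q, \<theta> is smaller than e. The surplus power e - \<theta> is not left
  to a maximal function but spent on a Hoelder-type bound against the global norm of f, and this
  produces the gain from L^p to L^q. The covering lemma \<open>stopping_cells_cover\<close> compares
  two measures cell by cell. It serves three times: for the weak-type bound, for the distortion of
  volume by a matrix, and for finding a cube half filled by a given set.\<close>

section \<open>Powers of extended nonnegative reals\<close>

lemma epowr_top [simp]: "epowr top r = top"
  by (simp add: epowr_def)

lemma epowr_ennreal: "0 \<le> x \<Longrightarrow> epowr (ennreal x) r = ennreal (x powr r)"
  by (simp add: epowr_def)

lemma epowr_0 [simp]: "epowr 0 r = 0"
  by (simp add: epowr_def)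

lemma epowr_1 [simp]: "epowr x 1 = x"
  by (cases x) (auto simp: epowr_def)

lemma epowr_eq_0_iff [simp]: "epowr x r = 0 \<longleftrightarrow> x = 0"
  by (cases x) (auto simp: epowr_def)

lemma epowr_eq_top_iff [simp]: "epowr x r = top \<longleftrightarrow> x = top"
  by (cases x) (auto simp: epowr_def)

lemma epowr_mono: "0 \<le> r \<Longrightarrow> x \<le> y \<Longrightarrow> epowr x r \<le> epowr y r"
  by (cases x; cases y) (auto simp: epowr_def top_unique intro!: powr_mono2)

text \<open>Holds for every exponent because \<open>epowr\<close> fixes 0 and \<open>top\<close>
  whatever \<open>r\<close> is, so the convention 0 * top = 0 acts alike on both sides.\<close>

lemma epowr_mult: "epowr (x * y) r = epowr x r * epowr y r"
proof (cases "x = 0 \<or> y = 0 \<or> x = top \<or> y = top")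
  case True
  then show ?thesis by (auto simp: ennreal_mult_eq_top_iff ennreal_top_mult ennreal_mult_top)
next
  case False
  then obtain a b where "x = ennreal a" "y = ennreal b" "0 \<le> a" "0 \<le> b"
    by (cases x; cases y) auto
  then show ?thesis
    by (simp add: epowr_ennreal powr_mult flip: ennreal_mult)
qed

lemma epowr_epowr: "epowr (epowr x a) b = epowr x (a * b)"
  by (cases x) (auto simp: epowr_ennreal powr_powr)

text \<open>An adjunction: as lower adjoint, \<open>epowr _ r\<close> preserves suprema, which
  replaces a continuity argument in \<open>epowr_SUP\<close>.\<close>

lemma epowr_le_iff:
  assumes "0 < r"
  shows "epowr x r \<le> y \<longleftrightarrow> x \<le> epowr y (1 / r)"
proof
  assume "epowr x r \<le> y"
  then have "epowr (epowr x r) (1 / r) \<le> epowr y (1 / r)"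
    using assms by (intro epowr_mono) auto
  then show "x \<le> epowr y (1 / r)" using assms by (simp add: epowr_epowr)
next
  assume "x \<le> epowr y (1 / r)"
  then have "epowr x r \<le> epowr (epowr y (1 / r)) r"
    using assms by (intro epowr_mono) auto
  then show "epowr x r \<le> y" using assms by (simp add: epowr_epowr)
qed

lemma ennreal_mult_epowr:
  "0 \<le> x \<Longrightarrow> 0 \<le> y \<Longrightarrow> ennreal x * epowr (ennreal y) r = ennreal (x * y powr r)"
  by (simp add: epowr_ennreal ennreal_mult)

lemma epowr_SUP:
  assumes "0 < r"
  shows "epowr (SUP i\<in>I. f i) r = (SUP i\<in>I. epowr (f i) r)"
proof (rule antisym)
  have "f i \<le> epowr (SUP i\<in>I. epowr (f i) r) (1 / r)" if "i \<in> I" for i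
    using SUP_upper[OF that, of "\<lambda>i. epowr (f i) r"] epowr_le_iff[OF assms] by blast
  then have "(SUP i\<in>I. f i) \<le> epowr (SUP i\<in>I. epowr (f i) r) (1 / r)"
    by (rule SUP_least)
  then show "epowr (SUP i\<in>I. f i) r \<le> (SUP i\<in>I. epowr (f i) r)"
    using epowr_le_iff[OF assms] by blast
  show "(SUP i\<in>I. epowr (f i) r) \<le> epowr (SUP i\<in>I. f i) r"
    using assms by (intro SUP_least epowr_mono) (auto intro: SUP_upper)
qed

lemma measurable_epowr [measurable]:
  assumes [measurable]: "f \<in> borel_measurable M"
  shows "(\<lambda>x. epowr (f x) r) \<in> borel_measurable M"
  unfolding epowr_def infinity_ennreal_def by measurable

section \<open>Maximal functions of a refining partition\<close>

text \<open>A dyadic filtration seen through labels: \<open>c j x\<close> names the level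
  \<open>j\<close> piece containing \<open>x\<close>. Levels start at a coarsest one, so a point
  with some good cell has a largest good cell; the price is that larger cubes are reached only by
  varying the partition.\<close>

locale refining_partition =
  fixes M :: "'a measure" and c :: "nat \<Rightarrow> 'a \<Rightarrow> 'b::countable"
  assumes space_M: "space M = UNIV"
    and sets_level: "{x. c j x = a} \<in> sets M"
    and refine: "c (Suc j) x = c (Suc j) y \<Longrightarrow> c j x = c j y"
begin

definition cell :: "nat \<Rightarrow> 'a \<Rightarrow> 'a set" where
  "cell j x = {y. c j y = c j x}"

lemma cell_sets: "cell j x \<in> sets M"
  unfolding cell_def by (rule sets_level)

lemma self_in_cell: "x \<in> cell j x"
  by (simp add: cell_def)

lemma cell_eqI: "y \<in> cell j x \<Longrightarrow> cell j y = cell j x"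
  by (simp add: cell_def)

lemma refine_le:
  assumes "i \<le> j" "c j x = c j y"
  shows "c i x = c i y"
  using assms by (induction j rule: dec_induct) (auto dest: refine)

text \<open>Such a function factors through the label of the cell, and the labels form a countable
  discrete space.\<close>

lemma measurable_cell_fun: "(\<lambda>x. F (cell j x)) \<in> M \<rightarrow>\<^sub>M N" if "range F \<subseteq> space N"
proof -
  have "c j \<in> M \<rightarrow>\<^sub>M count_space UNIV"
    by (subst measurable_count_space_eq2_countable)
      (auto simp: space_M vimage_def sets_level)
  moreover have "(\<lambda>a. F {y. c j y = a}) \<in> count_space UNIV \<rightarrow>\<^sub>M N"
    using that by auto
  ultimately show ?thesis
    unfolding cell_def by (rule measurable_compose)
qed

text \<open>The first cell around a point that satisfies \<open>P\<close> makes the covering disjoint.\<close>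

lemma stopping_cells_cover:
  assumes \<mu>: "sets \<mu> = sets M" and \<nu>: "sets \<nu> = sets M"
    and P: "\<And>j x. P (cell j x) \<Longrightarrow> emeasure \<mu> (cell j x) \<le> emeasure \<nu> (cell j x)"
  shows "emeasure \<mu> {x. \<exists>j. P (cell j x)} \<le> emeasure \<nu> {x. \<exists>j. P (cell j x)}"
proof -
  define I where "I = {(j, a). \<exists>x. c j x = a \<and> P (cell j x) \<and> (\<forall>i<j. \<not> P (cell i x))}"
  define X where "X = (\<lambda>(j, a). {y. c j y = a})"
  have disj: "disjoint_family_on X I"
    unfolding disjoint_family_on_def
  proof (intro ballI impI)
    fix u v assume uv: "u \<in> I" "v \<in> I" "u \<noteq> v"
    obtain j a k b where [simp]: "u = (j, a)" "v = (k, b)" by (cases u; cases v)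
    from uv(1) obtain x where x: "c j x = a" "P (cell j x)" "\<And>i. i < j \<Longrightarrow> \<not> P (cell i x)"
      by (auto simp: I_def)
    from uv(2) obtain y where y: "c k y = b" "P (cell k y)" "\<And>i. i < k \<Longrightarrow> \<not> P (cell i y)"
      by (auto simp: I_def)
    show "X u \<inter> X v = {}"
    proof (rule ccontr)
      assume "X u \<inter> X v \<noteq> {}"
      then obtain z where z: "c j z = a" "c k z = b" by (auto simp: X_def)
      have zx: "cell i z = cell i x" if "i \<le> j" for i
        using refine_le[OF that, of z x] z x by (simp add: cell_def)
      have zy: "cell i z = cell i y" if "i \<le> k" for i
        using refine_le[OF that, of z y] z y by (simp add: cell_def)
      \<comment> \<open>The common point \<open>z\<close> shares with \<open>x\<close> and with
        \<open>y\<close> every cell up to their own levels, so a strictly coarser good cell on one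
        side would contradict minimality on the other.\<close>
      have "\<not> j < k"
        using x(2) y(3)[of j] zx[of j] zy[of j] by auto
      moreover have "\<not> k < j"
        using y(2) x(3)[of k] zx[of k] zy[of k] by auto
      ultimately have "j = k" by simp
      with z uv show False by simp
    qed
  qed
  have X: "{x. \<exists>j. P (cell j x)} = \<Union> (X ` I)"
  proof safe
    fix x j assume "P (cell j x)"
    define m where "m = (LEAST j. P (cell j x))"
    have "(m, c m x) \<in> I"
      using LeastI[of "\<lambda>j. P (cell j x)", OF \<open>P (cell j x)\<close>]
      by (auto simp: I_def m_def dest: not_less_Least)
    moreover have "x \<in> X (m, c m x)" by (simp add: X_def)
    ultimately show "x \<in> \<Union> (X ` I)" by blast
  next
    fix x j a assume x: "x \<in> X (j, a)" and "(j, a) \<in> I"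
    then obtain y where "c j y = a" "P (cell j y)" by (auto simp: I_def)
    moreover from this x have "cell j x = cell j y" by (simp add: X_def cell_def)
    ultimately have "P (cell j x)" by simp
    then show "\<exists>j. P (cell j x)" ..
  qed
  have sets: "X i \<in> sets M" for i
    by (cases i) (simp add: X_def sets_level)
  have "emeasure \<mu> (X i) \<le> emeasure \<nu> (X i)" if "i \<in> I" for i
  proof -
    obtain j a where i: "i = (j, a)" by (cases i)
    with that obtain x where "c j x = a" "P (cell j x)" by (auto simp: I_def)
    with P[of j x] show ?thesis by (simp add: X_def i cell_def)
  qed
  then have "(\<integral>\<^sup>+i. emeasure \<mu> (X i) \<partial>count_space I) \<le> (\<integral>\<^sup>+i. emeasure \<nu> (X i) \<partial>count_space I)"
    by (intro nn_integral_mono) auto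
  then show ?thesis
    using sets \<mu> \<nu> disj unfolding X
    by (subst (1 2) emeasure_UN_countable) auto
qed

text \<open>Extended division gives 0 on cells of infinite measure, and on null cells as well, since
  there the integral vanishes and 0/0 is 0. The bounds below can therefore admit any \<mu> on the
  sigma-algebra of \<open>M\<close>.\<close>

definition maxfun :: "'a measure \<Rightarrow> ('a \<Rightarrow> ennreal) \<Rightarrow> 'a \<Rightarrow> ennreal" where
  "maxfun \<mu> g x = (SUP j. (\<integral>\<^sup>+y\<in>cell j x. g y \<partial>\<mu>) / emeasure \<mu> (cell j x))"

lemma measurable_maxfun: "maxfun \<mu> g \<in> borel_measurable M"
  unfolding maxfun_def
  by (intro borel_measurable_SUP measurable_cell_fun[where F = "\<lambda>C. (\<integral>\<^sup>+y\<in>C. g y \<partial>\<mu>) / emeasure \<mu> C"]) auto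

text \<open>The part of \<open>g\<close> that is at most \<open>t\<close> adds at most
  \<open>t\<close> to an average, so an average above \<open>2 * t\<close> leaves at least
  \<open>t\<close> for the part above \<open>t\<close>. Restricting the right side to
  \<open>t < g\<close> is what lets the bounds be summed over all heights.\<close>

lemma maxfun_weak_type:
  assumes \<mu>: "sets \<mu> = sets M" and g: "g \<in> borel_measurable M" and "0 < t"
  shows "ennreal t * emeasure \<mu> {x. ennreal (2 * t) < maxfun \<mu> g x}
           \<le> (\<integral>\<^sup>+x. g x * indicator {x. ennreal t < g x} x \<partial>\<mu>)"
proof -
  define h where "h x = g x * indicator {x. ennreal t < g x} x" for x
  note [measurable_cong] = \<mu>
  have [measurable]: "g \<in> borel_measurable \<mu>" using g by simp
  have [measurable]: "h \<in> borel_measurable \<mu>"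
    unfolding h_def by measurable
  define P where "P C \<longleftrightarrow> ennreal (2 * t) < (\<integral>\<^sup>+y\<in>C. g y \<partial>\<mu>) / emeasure \<mu> C" for C
  let ?\<mu>' = "density \<mu> (\<lambda>_. ennreal t)" and ?\<nu> = "density \<mu> h"
  have Y: "{x. ennreal (2 * t) < maxfun \<mu> g x} = {x. \<exists>j. P (cell j x)}"
    by (auto simp: P_def maxfun_def less_SUP_iff)
  have Y_sets: "{x. ennreal (2 * t) < maxfun \<mu> g x} \<in> sets \<mu>"
    using borel_measurable_less[of "\<lambda>_. ennreal (2 * t)" M "maxfun \<mu> g"] measurable_maxfun[of \<mu> g] \<mu> space_M
    by simp
  have "emeasure ?\<mu>' {x. \<exists>j. P (cell j x)} \<le> emeasure ?\<nu> {x. \<exists>j. P (cell j x)}"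
  proof (rule stopping_cells_cover)
    fix j x assume P: "P (cell j x)"
    define C where "C = cell j x"
    have C[measurable]: "C \<in> sets \<mu>" using cell_sets \<mu> by (simp add: C_def)
    from P have "(\<integral>\<^sup>+y\<in>C. g y \<partial>\<mu>) / emeasure \<mu> C \<noteq> 0" by (auto simp: P_def C_def)
    then have fin: "emeasure \<mu> C \<noteq> top" by (auto simp: ennreal_divide_eq_0_iff)
    then obtain m where m: "emeasure \<mu> C = ennreal m" "0 \<le> m" by (cases "emeasure \<mu> C") auto
    have "emeasure \<mu> C \<noteq> 0"
    proof
      assume "emeasure \<mu> C = 0"
      then have "C \<in> null_sets \<mu>" using C by auto
      then have "(\<integral>\<^sup>+y\<in>C. g y \<partial>\<mu>) = 0" by (rule nn_integral_null_set)
      with P show False by (simp add: P_def C_def)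
    qed
    then have "0 < m" using m by (cases "m = 0") auto
    have "ennreal (2 * t) * ennreal m \<le> (\<integral>\<^sup>+y\<in>C. g y \<partial>\<mu>) / ennreal m * ennreal m"
      using P m by (intro mult_right_mono) (auto simp: P_def C_def)
    also have "\<dots> = (\<integral>\<^sup>+y\<in>C. g y \<partial>\<mu>)"
      using \<open>0 < m\<close> by (simp add: ennreal_divide_times mult_divide_eq_ennreal)
    also have "\<dots> \<le> (\<integral>\<^sup>+y. h y * indicator C y + ennreal t * indicator C y \<partial>\<mu>)"
      by (intro nn_integral_mono) (auto simp: h_def not_less split: split_indicator)
    also have "\<dots> = (\<integral>\<^sup>+y\<in>C. h y \<partial>\<mu>) + ennreal t * ennreal m"
      using m by (subst nn_integral_add) (auto simp: nn_integral_cmult_indicator)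
    finally have "ennreal (t * m) + ennreal (t * m) \<le> ennreal (t * m) + (\<integral>\<^sup>+y\<in>C. h y \<partial>\<mu>)"
      using \<open>0 < t\<close> \<open>0 < m\<close> by (simp add: ac_simps flip: ennreal_mult ennreal_plus)
    \<comment> \<open>Cancelling is legitimate because \<open>t * m\<close> is finite; cells of
      infinite measure were excluded for this.\<close>
    then have "ennreal (t * m) \<le> (\<integral>\<^sup>+y\<in>C. h y \<partial>\<mu>)"
      by (rule ennreal_add_left_cancel_le[THEN iffD1, THEN disjE]) auto
    then show "emeasure ?\<mu>' (cell j x) \<le> emeasure ?\<nu> (cell j x)"
      using \<open>0 < t\<close> \<open>0 < m\<close> m C unfolding C_def[symmetric]
      by (simp add: emeasure_density nn_integral_cmult_indicator ennreal_mult)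
  qed (use \<mu> in auto)
  then have "ennreal t * emeasure \<mu> {x. ennreal (2 * t) < maxfun \<mu> g x}
      \<le> (\<integral>\<^sup>+x\<in>{x. ennreal (2 * t) < maxfun \<mu> g x}. h x \<partial>\<mu>)"
    using Y_sets by (simp add: emeasure_density nn_integral_cmult_indicator flip: Y)
  also have "\<dots> \<le> (\<integral>\<^sup>+x. h x \<partial>\<mu>)"
    by (intro nn_integral_mono) (auto split: split_indicator)
  finally show ?thesis by (simp add: h_def)
qed

end

section \<open>Layer-cake sums over powers of two\<close>

lemma epowr_le_dyadic_sum:
  assumes "0 < r"
  shows "epowr x r \<le> (\<integral>\<^sup>+k. ennreal (2 powr (r * (real_of_int k + 1)))
           * indicator {k. ennreal (2 powr real_of_int k) < x} k \<partial>count_space UNIV)"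
    (is "_ \<le> ?S")
proof (cases x)
  case (real a)
  show ?thesis
  proof (cases "a = 0")
    case False
    with real have "0 < a" by simp
    \<comment> \<open>The largest integer strictly below \<open>log 2 a\<close>: the level sets are
      strict, so the floor would fail when \<open>a\<close> is a power of two.\<close>
    define k where "k = \<lceil>log 2 a\<rceil> - 1"
    have k: "real_of_int k < log 2 a" "log 2 a \<le> real_of_int k + 1"
      unfolding k_def by linarith+
    have 1: "2 powr real_of_int k < a"
      using k(1) \<open>0 < a\<close> by (simp add: less_log_iff)
    have 2: "a \<le> 2 powr (real_of_int k + 1)"
      using k(2) \<open>0 < a\<close> by (simp add: log_le_iff)
    have "epowr x r \<le> ennreal (2 powr (r * (real_of_int k + 1)))"
      using real 2 assms powr_mono2[of r a "2 powr (real_of_int k + 1)"]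
      by (simp add: epowr_ennreal powr_powr mult.commute ennreal_leI)
    also have "\<dots> = ennreal (2 powr (r * (real_of_int k + 1)))
           * indicator {k. ennreal (2 powr real_of_int k) < x} k"
      using 1 real by (simp add: ennreal_lessI \<open>0 < a\<close>)
    also have "\<dots> \<le> ?S" by (rule nn_integral_ge_point) simp
    finally show ?thesis .
  qed (use real in simp)
next
  case top
  \<comment> \<open>At \<open>top\<close> every indicator equals 1, and single terms are already
    arbitrarily large.\<close>
  have "of_nat n \<le> ?S" for n :: nat
  proof -
    define k where "k = \<lceil>log 2 (real n + 1) / r\<rceil>"
    have "log 2 (real n + 1) \<le> r * (real_of_int k + 1)"
    proof -
      have "log 2 (real n + 1) / r \<le> real_of_int k + 1" unfolding k_def by linarith
      then show ?thesis using assms by (simp add: field_simps)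
    qed
    then have "real n + 1 \<le> 2 powr (r * (real_of_int k + 1))"
      by (simp add: log_le_iff)
    then have "of_nat n \<le> ennreal (2 powr (r * (real_of_int k + 1)))"
      by (simp flip: ennreal_of_nat_eq_real_of_nat)
    also have "\<dots> = ennreal (2 powr (r * (real_of_int k + 1)))
           * indicator {k. ennreal (2 powr real_of_int k) < x} k"
      by (simp add: top)
    also have "\<dots> \<le> ?S" by (rule nn_integral_ge_point) simp
    finally show ?thesis .
  qed
  then have "\<not> ?S < top"
    using ennreal_Ex_less_of_nat[of ?S] by (auto simp: not_le[symmetric])
  then show ?thesis by (simp add: less_top[symmetric])
qed

text \<open>The denominator sums a geometric series of ratio \<open>2 powr (1 - r)\<close>. The
  numerator collects \<open>2 powr (r + 1)\<close> from the discretised heights and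
  \<open>2 powr (r - 1)\<close> from rounding up to a power of two.\<close>

definition dyadic_const :: "real \<Rightarrow> real" where
  "dyadic_const r = 4 powr r / (1 - 2 powr (1 - r))"

lemma dyadic_const_pos: "1 < r \<Longrightarrow> 0 < dyadic_const r"
  unfolding dyadic_const_def by (intro divide_pos_pos) (auto intro: powr_less_one)

text \<open>The factor 2^(1 - k) is the 1/t of the weak-type bound at t = 2^(k - 1). For finite
  \<open>x\<close> the indices are bounded above, the largest term is comparable with x^r, and
  downwards the terms decay geometrically because \<open>1 < r\<close>.\<close>

lemma dyadic_sum_le_epowr:
  assumes "1 < r"
  shows "(\<integral>\<^sup>+k. ennreal (2 powr (r * (real_of_int k + 1)) * 2 powr (1 - real_of_int k))
           * (x * indicator {k. ennreal (2 powr (real_of_int k - 1)) < x} k) \<partial>count_space UNIV)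
         \<le> ennreal (dyadic_const r) * epowr x r" (is "?S \<le> _")
proof (cases x)
  case (real a)
  show ?thesis
  proof (cases "a = 0")
    case True
    with real show ?thesis by simp
  next
    case False
    with real have "0 < a" by simp
    define K where "K = \<lceil>log 2 a\<rceil>"
    have K: "real_of_int K - 1 < log 2 a" unfolding K_def by linarith
    then have K2: "2 powr real_of_int K \<le> 2 * a"
      using \<open>0 < a\<close> less_log_iff[of 2 a "real_of_int K - 1"]
      by (simp add: powr_diff field_simps)
    define b where "b = 2 powr (1 - r)"
    have b: "0 < b" "b < 1" using assms by (auto simp: b_def intro: powr_less_one)
    let ?f = "\<lambda>k::int. ennreal (2 powr (r + 1) * 2 powr (real_of_int k * (r - 1)) * a)"
    have iff: "ennreal (2 powr (real_of_int k - 1)) < x \<longleftrightarrow> k \<in> {..K}" for k :: int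
    proof -
      have "ennreal (2 powr (real_of_int k - 1)) < x \<longleftrightarrow> 2 powr (real_of_int k - 1) < a"
        using real by (simp add: ennreal_less_iff)
      also have "\<dots> \<longleftrightarrow> real_of_int k - 1 < log 2 a"
        using \<open>0 < a\<close> by (simp add: less_log_iff)
      also have "\<dots> \<longleftrightarrow> k \<le> K" unfolding K_def by linarith
      finally show ?thesis by simp
    qed
    have "?S = (\<integral>\<^sup>+k. ?f k * indicator {..K} k \<partial>count_space UNIV)"
      unfolding iff Collect_mem_eq
      by (intro nn_integral_cong)
        (auto simp: real ac_simps powr_add[symmetric] algebra_simps ennreal_mult[symmetric] split: split_indicator)
    also have "\<dots> = (\<integral>\<^sup>+k. ?f k \<partial>count_space {..K})"
      by (simp add: nn_integral_count_space_indicator)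
    also have "\<dots> = (\<integral>\<^sup>+n. ?f (K - int n) \<partial>count_space UNIV)"
      by (rule nn_integral_bij_count_space[symmetric])
        (auto intro!: bij_betwI[where g = "\<lambda>k. nat (K - k)"])
    also have "\<dots> = (\<Sum>n. ?f (K - int n))" by (rule nn_integral_count_space_nat)
    also have "\<dots> = (\<Sum>n. ennreal (2 powr (r + 1) * 2 powr (real_of_int K * (r - 1)) * a * b ^ n))"
    proof (intro suminf_cong arg_cong[where f = ennreal])
      fix n
      have "2 powr (real_of_int (K - int n) * (r - 1)) = 2 powr (real_of_int K * (r - 1)) * b powr real n"
        by (simp add: b_def powr_powr powr_add[symmetric] algebra_simps)
      then show "2 powr (r + 1) * 2 powr (real_of_int (K - int n) * (r - 1)) * a =
         2 powr (r + 1) * 2 powr (real_of_int K * (r - 1)) * a * b ^ n"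
        using b by (simp add: powr_realpow)
    qed
    also have "\<dots> = ennreal (2 powr (r + 1) * 2 powr (real_of_int K * (r - 1)) * a * (1 / (1 - b)))"
      using b \<open>0 < a\<close> by (intro suminf_ennreal_eq sums_mult geometric_sums) auto
    also have "\<dots> \<le> ennreal (dyadic_const r * a powr r)"
    proof (rule ennreal_leI)
      have "2 powr (real_of_int K * (r - 1)) = (2 powr real_of_int K) powr (r - 1)"
        by (simp add: powr_powr)
      also have "\<dots> \<le> (2 * a) powr (r - 1)"
        using K2 assms by (intro powr_mono2) auto
      finally have "2 powr (r + 1) * 2 powr (real_of_int K * (r - 1)) * a * (1 / (1 - b)) \<le>
          2 powr (r + 1) * (2 * a) powr (r - 1) * a * (1 / (1 - b))"
        using \<open>0 < a\<close> b by (intro mult_right_mono mult_left_mono) auto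
      also have "2 powr (r + 1) * (2 * a) powr (r - 1) * a = 4 powr r * a powr r"
      proof -
        have "(4::real) powr r = 2 powr (2 * r)"
          by (simp flip: powr_powr)
        moreover have "a powr (r - 1) * a = a powr r"
          using \<open>0 < a\<close> by (simp add: powr_diff)
        moreover have "(2::real) powr (r + 1) * 2 powr (r - 1) = 2 powr (2 * r)"
          by (simp flip: powr_add)
        ultimately show ?thesis
          using \<open>0 < a\<close> by (simp add: powr_mult) (metis (no_types, opaque_lifting) mult.assoc)
      qed
      finally show "2 powr (r + 1) * 2 powr (real_of_int K * (r - 1)) * a * (1 / (1 - b))
          \<le> dyadic_const r * a powr r"
        by (simp add: dyadic_const_def b_def)
    qed
    also have "\<dots> = ennreal (dyadic_const r) * epowr x r"
      using real dyadic_const_pos[OF assms] by (simp add: epowr_ennreal ennreal_mult)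
    finally show ?thesis .
  qed
next
  case top
  then show ?thesis using dyadic_const_pos[OF assms] by (simp add: ennreal_mult_top)
qed

context refining_partition
begin

text \<open>Weak-type bounds at all heights 2^(k - 1) are summed and the sum is brought back under
  the integral. Written as an integral over a countable counting space, it can be exchanged with the
  \<mu>-integral for any \<mu>.\<close>

lemma maxfun_strong_type:
  assumes \<mu>: "sets \<mu> = sets M" and g: "g \<in> borel_measurable M" and "1 < r"
  shows "(\<integral>\<^sup>+x. epowr (maxfun \<mu> g x) r \<partial>\<mu>) \<le> ennreal (dyadic_const r) * (\<integral>\<^sup>+x. epowr (g x) r \<partial>\<mu>)"
proof -
  note [measurable_cong] = \<mu>
  note [measurable] = measurable_maxfun
  have [measurable]: "g \<in> borel_measurable \<mu>" using g by simp
  have space: "space \<mu> = UNIV" using sets_eq_imp_space_eq[OF \<mu>] space_M by simp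
  have [measurable]: "maxfun \<mu> g \<in> borel_measurable \<mu>" by simp
  let ?a = "\<lambda>k::int. 2 powr (r * (real_of_int k + 1))"
  let ?Y = "\<lambda>k::int. {x. ennreal (2 powr real_of_int k) < maxfun \<mu> g x}"
  let ?G = "\<lambda>k::int. {x. ennreal (2 powr (real_of_int k - 1)) < g x}"
  have Y[measurable]: "?Y k \<in> sets \<mu>" for k
    using borel_measurable_less[of "\<lambda>_. ennreal (2 powr real_of_int k)" \<mu> "maxfun \<mu> g"]
    by (simp add: space)
  have G[measurable]: "?G k \<in> sets \<mu>" for k
    using borel_measurable_less[of "\<lambda>_. ennreal (2 powr (real_of_int k - 1))" \<mu> g]
    by (simp add: space)
  have "(\<integral>\<^sup>+x. epowr (maxfun \<mu> g x) r \<partial>\<mu>)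
      \<le> (\<integral>\<^sup>+x. \<integral>\<^sup>+k. ennreal (?a k) * indicator (?Y k) x \<partial>count_space UNIV \<partial>\<mu>)"
    using \<open>1 < r\<close>
    by (intro nn_integral_mono order_trans[OF epowr_le_dyadic_sum[of r]])
      (auto intro!: nn_integral_mono split: split_indicator)
  also have "\<dots> = (\<integral>\<^sup>+k. \<integral>\<^sup>+x. ennreal (?a k) * indicator (?Y k) x \<partial>\<mu> \<partial>count_space UNIV)"
    by (intro nn_integral_count_space_nn_integral) auto
  also have "\<dots> = (\<integral>\<^sup>+k. ennreal (?a k) * emeasure \<mu> (?Y k) \<partial>count_space UNIV)"
    by (simp add: nn_integral_cmult_indicator)
  also have "\<dots> \<le> (\<integral>\<^sup>+k. ennreal (?a k * 2 powr (1 - real_of_int k)) *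
      (\<integral>\<^sup>+x. g x * indicator (?G k) x \<partial>\<mu>) \<partial>count_space UNIV)"
  proof (rule nn_integral_mono)
    fix k :: int
    have eq: "2 * 2 powr (real_of_int k - 1) = 2 powr real_of_int k"
      by (simp add: powr_diff)
    have "ennreal (?a k) * emeasure \<mu> (?Y k) = ennreal (?a k * 2 powr (1 - real_of_int k)) *
       (ennreal (2 powr (real_of_int k - 1)) * emeasure \<mu> (?Y k))"
      by (simp add: mult.assoc[symmetric] ennreal_mult[symmetric] powr_add[symmetric])
    also have "\<dots> \<le> ennreal (?a k * 2 powr (1 - real_of_int k)) * (\<integral>\<^sup>+x. g x * indicator (?G k) x \<partial>\<mu>)"
      using maxfun_weak_type[OF \<mu> g, of "2 powr (real_of_int k - 1)"]
      by (intro mult_left_mono) (auto simp: eq)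
    finally show "ennreal (?a k) * emeasure \<mu> (?Y k) \<le> \<dots>" .
  qed
  also have "\<dots> = (\<integral>\<^sup>+k. \<integral>\<^sup>+x. ennreal (?a k * 2 powr (1 - real_of_int k)) *
      (g x * indicator (?G k) x) \<partial>\<mu> \<partial>count_space UNIV)"
    by (intro nn_integral_cong nn_integral_cmult[symmetric]) measurable
  also have "\<dots> = (\<integral>\<^sup>+x. \<integral>\<^sup>+k. ennreal (?a k * 2 powr (1 - real_of_int k)) *
      (g x * indicator (?G k) x) \<partial>count_space UNIV \<partial>\<mu>)"
    by (intro nn_integral_count_space_nn_integral[symmetric]) auto
  also have "\<dots> \<le> (\<integral>\<^sup>+x. ennreal (dyadic_const r) * epowr (g x) r \<partial>\<mu>)"
    by (intro nn_integral_mono order_trans[OF _ dyadic_sum_le_epowr[OF \<open>1 < r\<close>]])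
      (auto intro!: nn_integral_mono split: split_indicator)
  also have "\<dots> = ennreal (dyadic_const r) * (\<integral>\<^sup>+x. epowr (g x) r \<partial>\<mu>)"
    by (intro nn_integral_cmult) measurable
  finally show ?thesis .
qed

end

section \<open>Fractional maximal functions of a partition\<close>

text \<open>Above \<open>c\<close> one has x = x^(1 - p) x^p with x^(1 - p) at most c^(1 - p).
  Integrated and optimised in \<open>c\<close>, this stands in for Hoelder's inequality at the cost
  of a factor 2.\<close>

lemma young_truncation:
  assumes "0 < c" "1 < p"
  shows "x \<le> ennreal c + ennreal (c powr (1 - p)) * epowr x p"
proof (cases x)
  case (real a)
  have "a \<le> c + c powr (1 - p) * a powr p"
  proof (cases "a \<le> c")
    case True
    then show ?thesis using assms by (simp add: add_increasing2)
  next
    case False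
    then have "a = a powr (1 - p) * a powr p" using assms by (simp flip: powr_add)
    also have "\<dots> \<le> c powr (1 - p) * a powr p"
      using False assms by (intro mult_right_mono powr_mono2') auto
    finally show ?thesis using assms by simp
  qed
  then show ?thesis
    using real assms by (simp add: epowr_ennreal ennreal_leI flip: ennreal_mult ennreal_plus)
next
  case top
  then show ?thesis using assms by (simp add: ennreal_mult_top)
qed

text \<open>The arithmetic of a single cell: \<open>m\<close>, \<open>S\<close>, \<open>U\<close>
  are its Lebesgue, \<sigma>- and \<mu>-measure, \<open>F\<close> is the integral of f over it, and
  \<open>G\<close> the global p-energy. In F^e = F^d F^(p e/q) the first factor is spent on the
  Hoelder-type bound \<open>F\<close>, the second becomes a power of a \<sigma>-average.\<close>

lemma powr_interpolation_bound:
  fixes m S U F G K p p' q s e :: real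
  assumes pos: "0 < m" "0 < S" "0 < U" "0 \<le> F" "0 \<le> G" "0 \<le> K"
    and p: "1 < p" "p < q" and p': "1 / p + 1 / p' = 1"
    and s: "s = 1 / q + 1 / p'" and e: "e = q / (p' * s)"
    and F: "F \<le> 2 * S powr (1 / p') * G powr (1 / p)"
    and Ap: "U * S powr (q / p') \<le> K * m powr (q * s)"
  shows "(F / m powr s) powr e \<le> K * 2 powr ((1 - p / q) * e) * G powr ((1 / p - 1 / q) * e)
           * (m / U * (F / S) powr (p * e / q))"
proof -
  have "1 / p < 1" using p by simp
  then have "0 < 1 / p'" using p' by linarith
  then have "0 < p'" by simp
  have s0: "0 < s" using \<open>0 < p'\<close> p s by (simp add: add_pos_pos)
  have e0: "0 < e" using e s0 \<open>0 < p'\<close> p by simp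
  have se: "s * e = q / p'" using s0 e by simp
  have qs: "q * s = 1 + q / p'" using s p by (simp add: field_simps)
  \<comment> \<open>F^d yields S^(d/p'), and passing from F to F/S yields S^(p e/q); together they
    must give S^(q/p'), the power in the weight condition.\<close>
  have ex: "(1 / p') * ((1 - p / q) * e) = q / p' - p * e / q"
  proof -
    have "(1 / p') * (1 - p / q) + p / q = 1 / p' + (p / q) * (1 - 1 / p')"
      by (simp add: algebra_simps)
    also have "1 - 1 / p' = 1 / p" using p' by simp
    also have "1 / p' + (p / q) * (1 / p) = s" using p s by simp
    finally have "(1 / p') * (1 - p / q) + p / q = s" .
    then have "((1 / p') * (1 - p / q) + p / q) * e = q / p'" using se by simp
    then show ?thesis by (simp add: algebra_simps)
  qed
  define d where "d = (1 - p / q) * e"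
  have d0: "0 \<le> d" using e0 p by (simp add: d_def)
  have "F powr e = F powr d * F powr (p * e / q)"
    by (simp add: d_def algebra_simps flip: powr_add)
  also have "\<dots> \<le> (2 * S powr (1 / p') * G powr (1 / p)) powr d * F powr (p * e / q)"
    using F pos d0 by (intro mult_right_mono powr_mono2) auto
  also have "\<dots> = 2 powr d * S powr (q / p' - p * e / q) * G powr ((1 / p - 1 / q) * e) * F powr (p * e / q)"
  proof -
    have "(S powr (1 / p')) powr d = S powr (q / p' - p * e / q)"
      unfolding powr_powr d_def ex ..
    moreover have "(1 / p) * d = (1 / p - 1 / q) * e"
      using p by (simp add: d_def field_simps)
    then have "(G powr (1 / p)) powr d = G powr ((1 / p - 1 / q) * e)"
      unfolding powr_powr by (rule arg_cong)
    ultimately show ?thesis by (simp add: powr_mult)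
  qed
  also have "\<dots> = 2 powr d * G powr ((1 / p - 1 / q) * e) * S powr (q / p') * (F / S) powr (p * e / q)"
    using pos by (simp add: powr_diff powr_divide)
  finally have 1: "F powr e \<le> 2 powr d * G powr ((1 / p - 1 / q) * e) * S powr (q / p') * (F / S) powr (p * e / q)" .
  have "S powr (q / p') \<le> K * (m / U) * m powr (q / p')"
    using Ap pos by (simp add: qs powr_add field_simps)
  then have "S powr (q / p') / m powr (q / p') \<le> K * (m / U)"
    using pos by (simp add: pos_divide_le_eq)
  have "(F / m powr s) powr e = F powr e / m powr (q / p')"
    using pos by (simp add: powr_divide powr_powr se)
  also have "\<dots> \<le> (2 powr d * G powr ((1 / p - 1 / q) * e) * S powr (q / p') * (F / S) powr (p * e / q)) / m powr (q / p')"
    using 1 pos by (intro divide_right_mono) auto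
  also have "\<dots> = (2 powr d * G powr ((1 / p - 1 / q) * e) * (F / S) powr (p * e / q)) * (S powr (q / p') / m powr (q / p'))"
    by simp
  also have "\<dots> \<le> (2 powr d * G powr ((1 / p - 1 / q) * e) * (F / S) powr (p * e / q)) * (K * (m / U))"
    using \<open>S powr (q / p') / m powr (q / p') \<le> K * (m / U)\<close> by (intro mult_left_mono) auto
  finally show ?thesis by (simp add: d_def mult_ac)
qed

text \<open>The base is the constant of the cellwise bound, raised to p' s because e (p' s) = q.
  Then come the strong-type constants of \<mu> for the exponent p' s = 1 + p'/q and of \<sigma> for
  the exponent p.\<close>

definition frac_const :: "real \<Rightarrow> real \<Rightarrow> real \<Rightarrow> real" where
  "frac_const p q K =
     (let p' = p / (p - 1); s = 1 / q + 1 / p'; e = q / (p' * s)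
      in (K * 2 powr ((1 - p / q) * e)) powr (p' * s) * dyadic_const (p' * s) * dyadic_const p)"

lemma frac_const_nonneg:
  assumes "1 < p" "0 < q"
  shows "0 \<le> frac_const p q K"
proof -
  define p' where "p' = p / (p - 1)"
  have "0 < p'" using assms by (simp add: p'_def)
  then have "1 < p' * (1 / q + 1 / p')" using assms by (simp add: distrib_left)
  then show ?thesis
    unfolding frac_const_def Let_def p'_def[symmetric]
    using dyadic_const_pos[of p] dyadic_const_pos[of "p' * (1 / q + 1 / p')"] assms by simp
qed

lemma nn_set_integral_pos:
  assumes "f \<in> borel_measurable M" "\<And>x. 0 < f x" "A \<in> sets M" "emeasure M A \<noteq> 0"
  shows "(\<integral>\<^sup>+x\<in>A. f x \<partial>M) \<noteq> 0"
proof
  assume "(\<integral>\<^sup>+x\<in>A. f x \<partial>M) = 0"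
  then have "AE x in M. f x * indicator A x = 0"
    using assms by (subst (asm) nn_integral_0_iff_AE) auto
  then have "AE x in M. x \<notin> A"
  proof eventually_elim
    case (elim x)
    then show ?case using assms(2)[of x] by (auto simp: indicator_def split: if_splits)
  qed
  then have "emeasure M A = 0"
    using assms(3) by (simp add: AE_iff_measurable[OF _ refl] AE_iff_null_sets null_setsD1)
  with assms(4) show False by simp
qed

context refining_partition
begin

text \<open>On a Lebesgue grid with s = 1 - \<alpha>/n this is the dyadic version of
  M_\<alpha>.\<close>

definition frac_maxfun :: "real \<Rightarrow> ('a \<Rightarrow> ennreal) \<Rightarrow> 'a \<Rightarrow> ennreal" where
  "frac_maxfun s f x = (SUP j. (\<integral>\<^sup>+y\<in>cell j x. f y \<partial>M) / epowr (emeasure M (cell j x)) s)"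

lemma measurable_frac_maxfun [measurable]: "frac_maxfun s f \<in> borel_measurable M"
  unfolding frac_maxfun_def
  by (intro borel_measurable_SUP measurable_cell_fun[where F = "\<lambda>C. (\<integral>\<^sup>+y\<in>C. f y \<partial>M) / epowr (emeasure M C) s"]) auto

lemma frac_maxfun_bound:
  fixes w :: "'a \<Rightarrow> real" and f :: "'a \<Rightarrow> ennreal"
  assumes [measurable]: "w \<in> borel_measurable M" "f \<in> borel_measurable M"
    and w: "\<And>x. 0 < w x"
    and p: "1 < p" "p < q" and p': "1 / p + 1 / p' = 1" and s: "s = 1 / q + 1 / p'"
    and cell: "\<And>j x. emeasure M (cell j x) \<noteq> 0" "\<And>j x. emeasure M (cell j x) \<noteq> top"
    and "0 \<le> K"
    and Ap: "\<And>j x. (\<integral>\<^sup>+y\<in>cell j x. ennreal (w y powr q) \<partial>M)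
       * epowr (\<integral>\<^sup>+y\<in>cell j x. ennreal (w y powr - p') \<partial>M) (q / p')
       \<le> ennreal K * epowr (emeasure M (cell j x)) (q * s)"
    and fin: "(\<integral>\<^sup>+x. epowr (f x) p * ennreal (w x powr p) \<partial>M) \<noteq> top"
  shows "(\<integral>\<^sup>+x. epowr (frac_maxfun s f x) q * ennreal (w x powr q) \<partial>M)
    \<le> ennreal (frac_const p q K) * epowr (\<integral>\<^sup>+x. epowr (f x) p * ennreal (w x powr p) \<partial>M) (q / p)"
proof -
  have "1 / p < 1" using p by simp
  then have "0 < 1 / p'" using p' by linarith
  then have p'0: "0 < p'" by simp
  have s0: "0 < s" using p'0 p s by (simp add: add_pos_pos)
  define e where "e = q / (p' * s)"
  have e0: "0 < e" using s0 p'0 p by (simp add: e_def)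
  have p'eq: "p' = p / (p - 1)" using p p' p'0 by (simp add: field_simps)
  have r'1: "1 < p' * s" using p'0 p by (simp add: s field_simps)
  define \<sigma> where "\<sigma> = density M (\<lambda>x. ennreal (w x powr - p'))"
  define \<mu> where "\<mu> = density M (\<lambda>x. ennreal (w x powr q))"
  have sets: "sets \<sigma> = sets M" "sets \<mu> = sets M" by (auto simp: \<sigma>_def \<mu>_def)
  note [measurable] = cell_sets measurable_maxfun
  note [measurable_cong] = sets
  \<comment> \<open>Chosen so that g d\<sigma> = f dx, while p' p - p' = p turns the L^p(\<sigma>)
    norm of \<open>g\<close> into the weighted norm of \<open>f\<close>.\<close>
  define g where "g x = f x * ennreal (w x powr p')" for x
  have [measurable]: "g \<in> borel_measurable M" unfolding g_def[abs_def] by measurable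
  have g_f: "ennreal (w x powr - p') * g x = f x" for x
  proof -
    have "ennreal (w x powr - p') * g x = f x * (ennreal (w x powr p') * ennreal (w x powr - p'))"
      by (simp add: g_def ac_simps)
    also have "ennreal (w x powr p') * ennreal (w x powr - p') = 1"
      using w[of x] by (simp flip: ennreal_mult powr_add)
    finally show ?thesis by simp
  qed
  have gp: "ennreal (w x powr - p') * epowr (g x) p = epowr (f x) p * ennreal (w x powr p)" for x
  proof -
    have "p' * p - p' = p" using p'eq p by (simp add: field_simps)
    then have "w x powr - p' * (w x powr p') powr p = w x powr p"
      by (simp add: powr_powr flip: powr_add)
    then have "ennreal (w x powr - p') * ennreal ((w x powr p') powr p) = ennreal (w x powr p)"
      by (simp flip: ennreal_mult)
    then show ?thesis
      by (simp add: g_def epowr_mult epowr_ennreal) (metis mult.left_commute)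
  qed
  have G_eq: "(\<integral>\<^sup>+x. epowr (g x) p \<partial>\<sigma>) = (\<integral>\<^sup>+x. epowr (f x) p * ennreal (w x powr p) \<partial>M)"
    unfolding \<sigma>_def by (subst nn_integral_density) (auto simp: gp)
  then obtain G where G: "0 \<le> G" "(\<integral>\<^sup>+x. epowr (g x) p \<partial>\<sigma>) = ennreal G"
    using fin by (cases "\<integral>\<^sup>+x. epowr (g x) p \<partial>\<sigma>") auto
  define h where "h x = epowr (maxfun \<sigma> g x) (p * e / q)" for x
  have [measurable]: "h \<in> borel_measurable M" unfolding h_def[abs_def] by measurable
  \<comment> \<open>Dividing by w^q makes the Lebesgue integral of \<open>h\<close> over a cell a
    \<mu>-integral of \<open>k\<close>, hence visible to the maximal function of \<mu>.\<close>
  define k where "k x = h x * ennreal (w x powr - q)" for x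
  have [measurable]: "k \<in> borel_measurable M" unfolding k_def[abs_def] by measurable
  have k_h: "ennreal (w x powr q) * k x = h x" for x
  proof -
    have "ennreal (w x powr q) * k x = h x * (ennreal (w x powr q) * ennreal (w x powr - q))"
      by (simp add: k_def ac_simps)
    also have "ennreal (w x powr q) * ennreal (w x powr - q) = 1"
      using w[of x] by (simp flip: ennreal_mult powr_add)
    finally show ?thesis by simp
  qed
  define C1 where "C1 = K * 2 powr ((1 - p / q) * e)"
  have C1: "0 \<le> C1" using \<open>0 \<le> K\<close> by (simp add: C1_def)
  define D where "D = C1 * G powr ((1 / p - 1 / q) * e)"
  have D: "0 \<le> D" using C1 by (simp add: D_def)
  have key: "epowr ((\<integral>\<^sup>+y\<in>cell j x. f y \<partial>M) / epowr (emeasure M (cell j x)) s) e \<le> ennreal D * maxfun \<mu> k x" for j x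
  proof -
    define C where "C = cell j x"
    have [measurable]: "C \<in> sets M" by (simp add: C_def)
    obtain m where m: "emeasure M C = ennreal m" "0 < m"
      using cell[of j x] by (cases "emeasure M C") (auto simp: C_def order_less_le)
    have \<sigma>C: "emeasure \<sigma> C = (\<integral>\<^sup>+y\<in>C. ennreal (w y powr - p') \<partial>M)"
      by (simp add: \<sigma>_def emeasure_density)
    have \<mu>C: "emeasure \<mu> C = (\<integral>\<^sup>+y\<in>C. ennreal (w y powr q) \<partial>M)"
      by (simp add: \<mu>_def emeasure_density)
    \<comment> \<open>The finite product in the weight condition bounds both factors only because
      neither vanishes.\<close>
    have ne: "emeasure \<sigma> C \<noteq> 0" "emeasure \<mu> C \<noteq> 0"
      unfolding \<sigma>C \<mu>C by (rule nn_set_integral_pos; use w m in \<open>simp add: order_less_imp_not_eq2\<close>)+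
    have Ap': "emeasure \<mu> C * epowr (emeasure \<sigma> C) (q / p') \<le> ennreal (K * m powr (q * s))"
      using Ap[of j x] m \<open>0 \<le> K\<close> by (simp add: \<mu>C \<sigma>C epowr_ennreal ennreal_mult flip: C_def)
    then have prod: "emeasure \<mu> C * epowr (emeasure \<sigma> C) (q / p') \<noteq> top"
      by (metis ennreal_less_top leD)
    then have "emeasure \<mu> C \<noteq> top" "emeasure \<sigma> C \<noteq> top"
      using ne by (auto simp: ennreal_mult_eq_top_iff)
    with ne obtain S U where S: "emeasure \<sigma> C = ennreal S" "0 < S" and U: "emeasure \<mu> C = ennreal U" "0 < U"
      by (cases "emeasure \<sigma> C"; cases "emeasure \<mu> C") (auto simp: order_less_le)
    have Ap'': "U * S powr (q / p') \<le> K * m powr (q * s)"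
      using Ap' S U \<open>0 \<le> K\<close> by (simp add: epowr_ennreal flip: ennreal_mult)
    have Fg: "(\<integral>\<^sup>+y\<in>C. f y \<partial>M) = (\<integral>\<^sup>+y\<in>C. g y \<partial>\<sigma>)"
      unfolding \<sigma>_def by (subst nn_integral_density) (auto simp: g_f[symmetric] ac_simps)
    have F_le: "(\<integral>\<^sup>+y\<in>C. f y \<partial>M) \<le> ennreal (c * S + c powr (1 - p) * G)" if "0 < c" for c
    proof -
      have "(\<integral>\<^sup>+y\<in>C. g y \<partial>\<sigma>) \<le> (\<integral>\<^sup>+y. ennreal c * indicator C y + ennreal (c powr (1 - p)) * epowr (g y) p \<partial>\<sigma>)"
        using young_truncation[OF that p(1)] by (intro nn_integral_mono) (auto split: split_indicator)
      also have "\<dots> = ennreal c * emeasure \<sigma> C + ennreal (c powr (1 - p)) * (\<integral>\<^sup>+y. epowr (g y) p \<partial>\<sigma>)"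
        using sets by (subst nn_integral_add) (auto simp: nn_integral_cmult_indicator nn_integral_cmult)
      also have "\<dots> = ennreal (c * S + c powr (1 - p) * G)"
        using G S that by (simp add: ennreal_mult)
      finally show ?thesis unfolding Fg .
    qed
    from F_le[of 1] obtain F where F: "(\<integral>\<^sup>+y\<in>C. f y \<partial>M) = ennreal F" "0 \<le> F"
      by (cases "\<integral>\<^sup>+y\<in>C. f y \<partial>M") (auto simp: top_unique)
    have F_le': "F \<le> c * S + c powr (1 - p) * G" if "0 < c" for c
      using F_le[OF that] F S G that by (subst (asm) F(1), subst (asm) ennreal_le_iff) auto
    have F2: "F \<le> 2 * S powr (1 / p') * G powr (1 / p)"
    proof (cases "G = 0")
      case True
      \<comment> \<open>For G = 0 no \<open>c\<close> is optimal, so \<open>c\<close> is sent to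
        0.\<close>
      have "F \<le> 0"
      proof (rule field_le_epsilon)
        fix d :: real assume "0 < d"
        then show "F \<le> 0 + d" using F_le'[of "d / S"] True S by simp
      qed
      then show ?thesis using True by simp
    next
      case False
      with G have "0 < G" by simp
      have eq: "(1 / p) * (1 - p) = 1 / p - 1" using p by (simp add: field_simps)
      have p'2: "1 / p' = 1 - 1 / p" using p' by simp
      \<comment> \<open>This \<open>c\<close> makes the two terms of the truncation bound
        equal.\<close>
      have "F \<le> (G / S) powr (1 / p) * S + ((G / S) powr (1 / p)) powr (1 - p) * G"
        using \<open>0 < G\<close> S by (intro F_le') simp
      also have "(G / S) powr (1 / p) * S = S powr (1 / p') * G powr (1 / p)"
        using \<open>0 < G\<close> S by (simp add: p'2 powr_diff powr_divide)
      also have "((G / S) powr (1 / p)) powr (1 - p) * G = S powr (1 / p') * G powr (1 / p)"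
        unfolding powr_powr eq using \<open>0 < G\<close> S by (simp add: p'2 powr_diff powr_divide)
      finally show ?thesis by (simp add: mult_ac)
    qed
    \<comment> \<open>The bound holds at every point of the cell, so it can be raised to a power and
      integrated over the cell again.\<close>
    have avg: "ennreal (F / S) \<le> maxfun \<sigma> g y" if "y \<in> C" for y
    proof -
      have "cell j y = C" using that cell_eqI by (simp add: C_def)
      then have "(\<integral>\<^sup>+y\<in>C. g y \<partial>\<sigma>) / emeasure \<sigma> C \<le> maxfun \<sigma> g y"
        unfolding maxfun_def by (intro SUP_upper2[of j]) auto
      then show ?thesis using F S by (simp add: divide_ennreal flip: Fg)
    qed
    have "ennreal (m / U * (F / S) powr (p * e / q)) = ennreal ((F / S) powr (p * e / q)) * emeasure M C / ennreal U"
      using m U by (simp add: divide_ennreal ac_simps flip: ennreal_mult)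
    also have "\<dots> = (\<integral>\<^sup>+y. ennreal ((F / S) powr (p * e / q)) * indicator C y \<partial>M) / ennreal U"
      by (simp add: nn_integral_cmult_indicator)
    also have "\<dots> \<le> (\<integral>\<^sup>+y\<in>C. h y \<partial>M) / ennreal U"
    proof (intro divide_right_mono_ennreal nn_integral_mono)
      fix y
      show "ennreal ((F / S) powr (p * e / q)) * indicator C y \<le> h y * indicator C y"
      proof (cases "y \<in> C")
        case True
        then show ?thesis
          using epowr_mono[OF _ avg[OF True], of "p * e / q"] F S p e0
          by (simp add: h_def epowr_ennreal)
      qed simp
    qed
    also have "(\<integral>\<^sup>+y\<in>C. h y \<partial>M) = (\<integral>\<^sup>+y\<in>C. k y \<partial>\<mu>)"
      unfolding \<mu>_def by (subst nn_integral_density) (auto simp: k_h[symmetric] ac_simps)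
    also have "\<dots> / ennreal U \<le> maxfun \<mu> k x"
      unfolding maxfun_def using U by (intro SUP_upper2[of j]) (auto simp: C_def)
    finally have M: "ennreal (m / U * (F / S) powr (p * e / q)) \<le> maxfun \<mu> k x" .
    have "epowr ((\<integral>\<^sup>+y\<in>C. f y \<partial>M) / epowr (emeasure M C) s) e = ennreal ((F / m powr s) powr e)"
      using F m by (simp add: epowr_ennreal divide_ennreal)
    also have "\<dots> \<le> ennreal (D * (m / U * (F / S) powr (p * e / q)))"
      unfolding D_def C1_def using m S U F G \<open>0 \<le> K\<close> p p' s F2 Ap''
      by (intro ennreal_leI powr_interpolation_bound[where p' = p' and s = s]) (auto simp: e_def)
    also have "\<dots> \<le> ennreal D * maxfun \<mu> k x"
      unfolding ennreal_mult'[OF D] by (intro mult_left_mono M) simp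
    finally show ?thesis by (simp add: C_def)
  qed
  have pt: "epowr (frac_maxfun s f x) q \<le> ennreal (D powr (p' * s)) * epowr (maxfun \<mu> k x) (p' * s)" for x
  proof -
    have "epowr (frac_maxfun s f x) e \<le> ennreal D * maxfun \<mu> k x"
      unfolding frac_maxfun_def epowr_SUP[OF e0] by (intro SUP_least key)
    then have "epowr (epowr (frac_maxfun s f x) e) (p' * s) \<le> epowr (ennreal D * maxfun \<mu> k x) (p' * s)"
      using r'1 by (intro epowr_mono) auto
    moreover have "e * (p' * s) = q" using p'0 s0 by (simp add: e_def)
    ultimately show ?thesis using D by (simp add: epowr_epowr epowr_mult epowr_ennreal)
  qed
  have kp: "ennreal (w x powr q) * epowr (k x) (p' * s) = ennreal (w x powr - p') * epowr (maxfun \<sigma> g x) p" for x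
  proof -
    have 1: "p * e / q * (p' * s) = p" using p'0 s0 p by (simp add: e_def)
    \<comment> \<open>As p' s = 1 + p'/q, the power of \<open>w\<close> left over is exactly the
      density of \<sigma>.\<close>
    have 2: "q - q * (p' * s) = - p'" using p'0 p by (simp add: s field_simps)
    have "ennreal (w x powr q) * epowr (k x) (p' * s) =
        epowr (h x) (p' * s) * ennreal (w x powr q * w x powr (- q * (p' * s)))"
      by (simp add: k_def epowr_mult epowr_ennreal powr_powr ennreal_mult ac_simps)
    also have "w x powr q * w x powr (- q * (p' * s)) = w x powr - p'"
      using 2 by (simp flip: powr_add)
    also have "epowr (h x) (p' * s) = epowr (maxfun \<sigma> g x) p"
      unfolding h_def epowr_epowr 1 ..
    finally show ?thesis by (simp add: ac_simps)
  qed
  have "(\<integral>\<^sup>+x. epowr (frac_maxfun s f x) q * ennreal (w x powr q) \<partial>M)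
      = (\<integral>\<^sup>+x. epowr (frac_maxfun s f x) q \<partial>\<mu>)"
    unfolding \<mu>_def by (subst nn_integral_density) (auto simp: ac_simps)
  also have "\<dots> \<le> (\<integral>\<^sup>+x. ennreal (D powr (p' * s)) * epowr (maxfun \<mu> k x) (p' * s) \<partial>\<mu>)"
    using pt by (intro nn_integral_mono)
  also have "\<dots> = ennreal (D powr (p' * s)) * (\<integral>\<^sup>+x. epowr (maxfun \<mu> k x) (p' * s) \<partial>\<mu>)"
    by (intro nn_integral_cmult) measurable
  also have "\<dots> \<le> ennreal (D powr (p' * s)) * (ennreal (dyadic_const (p' * s)) * (\<integral>\<^sup>+x. epowr (k x) (p' * s) \<partial>\<mu>))"
    using sets r'1 by (intro mult_left_mono maxfun_strong_type) auto
  also have "(\<integral>\<^sup>+x. epowr (k x) (p' * s) \<partial>\<mu>) = (\<integral>\<^sup>+x. epowr (maxfun \<sigma> g x) p \<partial>\<sigma>)"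
    unfolding \<mu>_def \<sigma>_def by (subst (1 2) nn_integral_density) (auto simp: kp[unfolded \<sigma>_def])
  also have "\<dots> \<le> ennreal (dyadic_const p) * ennreal G"
    using maxfun_strong_type[of \<sigma> g p] sets p G by simp
  also have "ennreal (D powr (p' * s)) * (ennreal (dyadic_const (p' * s)) * (ennreal (dyadic_const p) * ennreal G))
      = ennreal (frac_const p q K) * epowr (ennreal G) (q / p)"
  proof -
    \<comment> \<open>The surplus power contributes G^(q/p - 1) and the final norm one more
      \<open>G\<close>, which restores the homogeneity of the claim.\<close>
    have "(1 / p - 1 / q) * e * (p' * s) = q / p - 1" using p'0 s0 p by (simp add: e_def field_simps)
    then have "D powr (p' * s) = C1 powr (p' * s) * G powr (q / p - 1)"
      using C1 G by (simp add: D_def powr_mult powr_powr)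
    moreover have "G powr (q / p - 1) * G = G powr (q / p)"
      using G by (cases "G = 0") (auto simp: powr_diff)
    ultimately have "D powr (p' * s) * (dyadic_const (p' * s) * (dyadic_const p * G)) = frac_const p q K * G powr (q / p)"
      unfolding frac_const_def Let_def p'eq[symmetric] s[symmetric] e_def[symmetric] C1_def[symmetric]
      by (simp add: ac_simps)
    then show ?thesis
      using G r'1 p dyadic_const_pos[of p] dyadic_const_pos[of "p' * s"]
      by (simp add: epowr_ennreal flip: ennreal_mult)
        (simp add: ennreal_mult''[symmetric])
  qed
  finally show ?thesis using G by (simp flip: G_eq)
    (metis mult_left_mono zero_le)
qed

end

section \<open>Dyadic grids\<close>

lemma lebesgue_cube:
  fixes a :: "real ^ 'n"
  assumes "0 < l"
  shows "emeasure lebesgue (cbox a (a + (\<chi> i. l))) = ennreal (l ^ CARD('n))"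
    and "emeasure lebesgue (box a (a + (\<chi> i. l))) = ennreal (l ^ CARD('n))"
proof -
  let ?b = "a + (\<chi> i. l)"
  have le: "a \<bullet> b \<le> ?b \<bullet> b" if "b \<in> Basis" for b
    using that assms by (auto simp: Basis_vec_def inner_axis)
  have ne: "cbox a ?b \<noteq> {}"
    using le by (simp add: box_ne_empty)
  have "measure lborel (cbox a ?b) = l ^ CARD('n)"
    using content_cbox_cart[OF ne] by simp
  moreover have "emeasure lborel (cbox a ?b) = ennreal (measure lborel (cbox a ?b))"
    using emeasure_eq_ennreal_measure[of lborel "cbox a ?b"] emeasure_lborel_cbox_finite[of a ?b] by auto
  ultimately have *: "emeasure lborel (cbox a ?b) = ennreal (l ^ CARD('n))" by simp
  then show "emeasure lebesgue (cbox a ?b) = ennreal (l ^ CARD('n))" by simp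
  have "emeasure lborel (box a ?b) = emeasure lborel (cbox a ?b)"
    by (simp add: emeasure_lborel_cbox_eq emeasure_lborel_box_eq)
  then show "emeasure lebesgue (box a ?b) = ennreal (l ^ CARD('n))" using * by simp
qed

text \<open>Half-open cubes of side L/2^j with a vertex at \<open>t\<close>, coded by their lower
  corners in units of the side. Half-open cubes make each level an exact partition.\<close>

definition grid_index :: "real \<Rightarrow> real ^ 'n \<Rightarrow> nat \<Rightarrow> real ^ 'n \<Rightarrow> int ^ 'n" where
  "grid_index L t j x = (\<chi> i. \<lfloor>(x $ i - t $ i) * 2 ^ j / L\<rfloor>)"

lemma grid_level_eq:
  fixes t :: "real ^ 'n"
  assumes "0 < L"
  defines "u a j \<equiv> (\<chi> i. real_of_int (a $ i) * (L / 2 ^ j) + t $ i)"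
  shows "{x. grid_index L t j x = a} = {x. \<forall>i. u a j $ i \<le> x $ i \<and> x $ i < u a j $ i + L / 2 ^ j}"
  using assms by (auto simp: grid_index_def u_def vec_eq_iff floor_eq_iff field_simps)

lemma refining_partition_grid:
  fixes t :: "real ^ 'n"
  assumes "0 < L"
  shows "refining_partition lebesgue (grid_index L t)"
proof
  show "space lebesgue = (UNIV :: (real ^ 'n) set)" by simp
  fix j and a :: "int ^ 'n"
  have "{x. grid_index L t j x = a} \<in> sets borel"
    unfolding grid_level_eq[OF assms] by measurable
  then show "{x. grid_index L t j x = a} \<in> sets lebesgue"
    by (simp add: sets_completionI_sets)
next
  fix j and x y :: "real ^ 'n"
  assume *: "grid_index L t (Suc j) x = grid_index L t (Suc j) y"
  \<comment> \<open>The floor of a half is the integer half of the floor, so the finer index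
    determines the coarser one.\<close>
  have "\<lfloor>(z $ i - t $ i) * 2 ^ j / L\<rfloor> = \<lfloor>(z $ i - t $ i) * 2 ^ Suc j / L\<rfloor> div 2" for z i
    using floor_divide_real_eq_div[of 2 "(z $ i - t $ i) * 2 ^ Suc j / L"] by simp
  with * show "grid_index L t j x = grid_index L t j y"
    by (simp add: grid_index_def vec_eq_iff)
qed

abbreviation "grid_cell L t \<equiv> refining_partition.cell (grid_index L t)"

lemma grid_cell_def:
  "0 < L \<Longrightarrow> grid_cell L t j x = {y. grid_index L t j y = grid_index L t j x}"
  by (rule refining_partition.cell_def[OF refining_partition_grid])

text \<open>A half-open cell lies between the open and the closed cube with the same corners, and
  these have the same volume.\<close>

lemma grid_cell_in_cube:
  fixes x :: "real ^ 'n"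
  assumes "0 < L"
  obtains a where "grid_cell L t j x \<subseteq> cbox a (a + (\<chi> i. L / 2 ^ j))"
    and "emeasure lebesgue (grid_cell L t j x) = ennreal ((L / 2 ^ j) ^ CARD('n))"
proof -
  define a where "a = (\<chi> i. real_of_int (grid_index L t j x $ i) * (L / 2 ^ j) + t $ i)"
  let ?b = "a + (\<chi> i. L / 2 ^ j)"
  have eq: "grid_cell L t j x = {y. \<forall>i. a $ i \<le> y $ i \<and> y $ i < a $ i + L / 2 ^ j}"
    unfolding grid_cell_def[OF assms] grid_level_eq[OF assms] a_def by simp
  have 1: "grid_cell L t j x \<subseteq> cbox a ?b"
    unfolding eq by (auto simp: mem_box_cart less_imp_le)
  have 2: "box a ?b \<subseteq> grid_cell L t j x"
    unfolding eq by (auto simp: mem_box_cart less_imp_le)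
  have [simp]: "grid_cell L t j x \<in> sets lebesgue"
    by (rule refining_partition.cell_sets[OF refining_partition_grid[OF assms]])
  have "0 < L / 2 ^ j" using assms by simp
  note cube = lebesgue_cube[OF this, of a]
  have "emeasure lebesgue (grid_cell L t j x) = ennreal ((L / 2 ^ j) ^ CARD('n))"
  proof (rule antisym)
    show "emeasure lebesgue (grid_cell L t j x) \<le> ennreal ((L / 2 ^ j) ^ CARD('n))"
      using emeasure_mono[OF 1, of lebesgue] cube by simp
    show "ennreal ((L / 2 ^ j) ^ CARD('n)) \<le> emeasure lebesgue (grid_cell L t j x)"
      using emeasure_mono[OF 2, of lebesgue] cube by simp
  qed
  with 1 show ?thesis by (rule that)
qed

lemma grid_cell_dist:
  fixes x y :: "real ^ 'n"
  assumes "0 < L" "y \<in> grid_cell L t j x"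
  shows "dist x y \<le> real CARD('n) * (L / 2 ^ j)"
proof -
  obtain a where "grid_cell L t j x \<subseteq> cbox a (a + (\<chi> i. L / 2 ^ j))"
    using grid_cell_in_cube[OF assms(1)] by blast
  moreover have "x \<in> grid_cell L t j x"
    by (rule refining_partition.self_in_cell[OF refining_partition_grid[OF assms(1)]])
  ultimately have xy: "x \<in> cbox a (a + (\<chi> i. L / 2 ^ j))" "y \<in> cbox a (a + (\<chi> i. L / 2 ^ j))"
    using assms(2) by auto
  have "dist x y \<le> (\<Sum>i\<in>UNIV. \<bar>(x - y) $ i\<bar>)"
    unfolding dist_norm by (rule norm_le_l1_cart)
  also have "\<dots> \<le> (\<Sum>i\<in>(UNIV :: 'n set). L / 2 ^ j)"
  proof (rule sum_mono)
    fix i :: 'n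
    have "a $ i \<le> x $ i \<and> x $ i \<le> a $ i + L / 2 ^ j" "a $ i \<le> y $ i \<and> y $ i \<le> a $ i + L / 2 ^ j"
      using xy by (auto simp: mem_box_cart)
    then show "\<bar>(x - y) $ i\<bar> \<le> L / 2 ^ j" by (auto simp: abs_le_iff)
  qed
  finally show ?thesis by simp
qed

lemma grid_cell_in_open:
  fixes x :: "real ^ 'n"
  assumes "0 < L" "open U" "x \<in> U"
  obtains j where "grid_cell L t j x \<subseteq> U"
proof -
  obtain e where e: "0 < e" "ball x e \<subseteq> U"
    using assms open_contains_ball by blast
  obtain j where j: "real CARD('n) * L / e < 2 ^ j"
    using real_arch_pow[of 2 "real CARD('n) * L / e"] by auto
  have "grid_cell L t j x \<subseteq> ball x e"
  proof
    fix y assume "y \<in> grid_cell L t j x"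
    from grid_cell_dist[OF assms(1) this] have "dist x y \<le> real CARD('n) * (L / 2 ^ j)" .
    also have "\<dots> < e" using j \<open>0 < e\<close> by (simp add: field_simps)
    finally show "y \<in> ball x e" by simp
  qed
  with e that show ?thesis by blast
qed

text \<open>Feeds \<open>stopping_cells_cover\<close> with the property of being contained in
  \<open>U\<close>, so that inequalities between measures pass from cells to open sets.\<close>

lemma open_eq_grid_cells:
  fixes U :: "(real ^ 'n) set"
  assumes "0 < L" "open U"
  shows "{x. \<exists>j. grid_cell L t j x \<subseteq> U} = U"
proof safe
  fix x j assume "grid_cell L t j x \<subseteq> U"
  then show "x \<in> U"
    using refining_partition.self_in_cell[OF refining_partition_grid[OF assms(1)]] by blast
next
  fix x assume "x \<in> U"
  with assms show "\<exists>j. grid_cell L t j x \<subseteq> U"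
    by (metis grid_cell_in_open)
qed

text \<open>If both failed, an integer and an integer translated by 2^j/3 would lie in one half-open
  interval of length below 1/3. Three times their difference is an integer of absolute value below
  1, hence 0, and 3 would divide a power of 2.\<close>

lemma floor_eq_or_shifted_floor_eq:
  fixes u v :: real
  assumes "u \<le> v" "v - u < 1 / 3"
  shows "\<lfloor>u\<rfloor> = \<lfloor>v\<rfloor> \<or> \<lfloor>u - 2 ^ j / 3\<rfloor> = \<lfloor>v - 2 ^ j / 3\<rfloor>"
proof (rule ccontr)
  assume "\<not> ?thesis"
  moreover have "\<lfloor>u\<rfloor> \<le> \<lfloor>v\<rfloor>" "\<lfloor>u - 2 ^ j / 3\<rfloor> \<le> \<lfloor>v - 2 ^ j / 3\<rfloor>"
    using assms by (auto intro: floor_mono)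
  ultimately have less: "\<lfloor>u\<rfloor> + 1 \<le> \<lfloor>v\<rfloor>" "\<lfloor>u - 2 ^ j / 3\<rfloor> + 1 \<le> \<lfloor>v - 2 ^ j / 3\<rfloor>"
    by linarith+
  define m k where "m = \<lfloor>v\<rfloor>" and "k = \<lfloor>v - 2 ^ j / 3\<rfloor>"
  have "u < real_of_int m" "real_of_int m \<le> v" "u - 2 ^ j / 3 < real_of_int k" "real_of_int k \<le> v - 2 ^ j / 3"
    using less unfolding m_def k_def by linarith+
  then have "real_of_int m - real_of_int k - 2 ^ j / 3 < 1 / 3" "- (1 / 3) < real_of_int m - real_of_int k - 2 ^ j / 3"
    using assms by linarith+
  then have "\<bar>3 * (real_of_int m - real_of_int k) - 2 ^ j\<bar> < 1"
    by (simp add: abs_less_iff algebra_simps)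
  then have "\<bar>real_of_int (3 * (m - k) - 2 ^ j)\<bar> < 1"
    by simp
  then have "3 * (m - k) = 2 ^ j" by linarith
  then have "(3::int) dvd 2 ^ j" by (metis dvd_triv_left)
  then have "(3::int) dvd 2" by (rule prime_dvd_power[rotated]) simp
  then show False by simp
qed

text \<open>The one-third trick: at every scale the endpoints of the grid and those of the grid
  translated by a third of the largest side are a third of the current side apart.\<close>

lemma cube_in_shifted_grid_cell:
  fixes a x :: "real ^ 'n"
  assumes "0 < l" "3 * l < L" and x: "x \<in> cbox a (a + (\<chi> i. l))"
  obtains t j where "\<And>i. t $ i \<in> {0, L / 3}" "cbox a (a + (\<chi> i. l)) \<subseteq> grid_cell L t j x"
    "L / 2 ^ j \<le> 6 * l"
proof -
  have "0 < L" using assms by simp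
  \<comment> \<open>The level wanted is one whose side exceeds 3 l while half of it does not; its
    side is then at most 6 l.\<close>
  define P where "P j \<longleftrightarrow> 3 * l \<ge> L / 2 ^ j" for j :: nat
  obtain j0 where "L / (3 * l) < 2 ^ j0"
    using real_arch_pow[of 2 "L / (3 * l)"] by auto
  then have "P j0" using \<open>0 < l\<close> by (simp add: P_def field_simps)
  moreover have "\<not> P 0" using assms by (simp add: P_def)
  ultimately obtain j where j: "\<not> P j" "P (Suc j)"
    using ex_least_nat_less[of P j0] by (metis lessI order_refl)
  define h where "h = L / 2 ^ j"
  have h: "3 * l < h" "h \<le> 6 * l" "0 < h" using j \<open>0 < L\<close> by (auto simp: P_def h_def field_simps)
  have Lh: "L = h * 2 ^ j" by (simp add: h_def)
  \<comment> \<open>The shift is decided coordinate by coordinate, so 2^n translates suffice for all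
    cubes with 3 l < L.\<close>
  define t where "t = (\<chi> i. if \<lfloor>a $ i / h\<rfloor> = \<lfloor>(a $ i + l) / h\<rfloor> then 0 else L / 3)"
  have t: "t $ i \<in> {0, L / 3}" for i by (simp add: t_def)
  have "grid_index L t j y = grid_index L t j a" if "y \<in> cbox a (a + (\<chi> i. l))" for y
    unfolding grid_index_def vec_eq_iff vec_lambda_beta
  proof
    fix i
    have y: "a $ i \<le> y $ i" "y $ i \<le> a $ i + l" using that by (auto simp: mem_box_cart)
    have eq: "(z - t $ i) * 2 ^ j / L = (z - t $ i) / h" for z
      using \<open>0 < h\<close> by (simp add: Lh)
    have "\<lfloor>a $ i / h\<rfloor> = \<lfloor>(a $ i + l) / h\<rfloor> \<or> \<lfloor>a $ i / h - 2 ^ j / 3\<rfloor> = \<lfloor>(a $ i + l) / h - 2 ^ j / 3\<rfloor>"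
      using h \<open>0 < l\<close> by (intro floor_eq_or_shifted_floor_eq) (auto simp: field_simps)
    moreover have "(z - L / 3) / h = z / h - 2 ^ j / 3" for z
      using \<open>0 < h\<close> by (simp add: Lh field_simps)
    ultimately have *: "\<lfloor>(a $ i - t $ i) / h\<rfloor> = \<lfloor>(a $ i + l - t $ i) / h\<rfloor>"
      by (auto simp: t_def)
    have "\<lfloor>(a $ i - t $ i) / h\<rfloor> \<le> \<lfloor>(y $ i - t $ i) / h\<rfloor>" "\<lfloor>(y $ i - t $ i) / h\<rfloor> \<le> \<lfloor>(a $ i + l - t $ i) / h\<rfloor>"
      using y h by (auto intro!: floor_mono divide_right_mono)
    with * show "\<lfloor>(y $ i - t $ i) * 2 ^ j / L\<rfloor> = \<lfloor>(a $ i - t $ i) * 2 ^ j / L\<rfloor>"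
      unfolding eq by linarith
  qed
  with x have "cbox a (a + (\<chi> i. l)) \<subseteq> grid_cell L t j x"
    unfolding grid_cell_def[OF \<open>0 < L\<close>] by auto
  with t h show ?thesis by (intro that[of t j]) (auto simp: h_def)
qed

section \<open>Linear changes of variables and the weight classes\<close>

lemma
  fixes A :: "real ^ 'n ^ 'n"
  assumes "invertible A"
  shows matrix_inv_mult: "A *v (matrix_inv A *v x) = x" "matrix_inv A *v (A *v x) = x"
    and invertible_matrix_inv: "invertible (matrix_inv A)"
proof -
  have *: "A ** matrix_inv A = mat 1 \<and> matrix_inv A ** A = mat 1"
    using assms unfolding invertible_def matrix_inv_def by (rule someI_ex)
  then show "A *v (matrix_inv A *v x) = x" "matrix_inv A *v (A *v x) = x"
    by (simp_all add: matrix_vector_mul_assoc)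
  show "invertible (matrix_inv A)" using * by (auto simp: invertible_def)
qed

lemma vimage_matrix_eq:
  fixes A :: "real ^ 'n ^ 'n"
  assumes "invertible A"
  shows "(*v) A -` S = (*v) (matrix_inv A) ` S"
proof safe
  fix x assume "A *v x \<in> S"
  then show "x \<in> (*v) (matrix_inv A) ` S"
    using matrix_inv_mult(2)[OF assms, of x] by (metis imageI)
next
  fix x assume "x \<in> S"
  then show "matrix_inv A *v x \<in> (*v) A -` S"
    using matrix_inv_mult(1)[OF assms] by simp
qed

text \<open>Continuity alone handles Borel sets. For Lebesgue sets the preimage is written as an
  image under the inverse, and linear images of Lebesgue sets are Lebesgue sets.\<close>

lemma measurable_matrix_lebesgue:
  fixes A :: "real ^ 'n ^ 'n"
  assumes "invertible A"
  shows "(*v) A \<in> lebesgue \<rightarrow>\<^sub>M lebesgue"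
proof (rule measurableI)
  fix S :: "(real ^ 'n) set" assume "S \<in> sets lebesgue"
  then have "(*v) (matrix_inv A) ` S \<in> sets lebesgue"
    by (rule differentiable_image_in_sets_lebesgue) (auto intro: linear_imp_differentiable_on)
  then show "(*v) A -` S \<inter> space lebesgue \<in> sets lebesgue"
    by (simp add: vimage_matrix_eq[OF assms])
qed simp

text \<open>Any constant \<open>C\<close> suffices below, so the size of the images of grid cells replaces the
  determinant formula.\<close>

lemma emeasure_vimage_matrix_le:
  fixes A :: "real ^ 'n ^ 'n"
  assumes "invertible A"
  obtains C where "0 < C"
    "\<And>S. S \<in> sets lebesgue \<Longrightarrow> emeasure lebesgue ((*v) A -` S) \<le> ennreal C * emeasure lebesgue S"
proof -
  let ?B = "matrix_inv A"
  let ?\<nu> = "distr lebesgue lebesgue ((*v) A)"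
  have \<nu>: "emeasure ?\<nu> S = emeasure lebesgue ((*v) A -` S)" if "S \<in> sets lebesgue" for S
    using that by (simp add: emeasure_distr[OF measurable_matrix_lebesgue[OF assms]] del: emeasure_completion)
  obtain b where b: "0 < b" "\<And>x. norm (?B *v x) \<le> b * norm x"
    using linear_bounded_pos[of "(*v) ?B"] by (auto simp: mult.commute)
  define r where "r = b * real CARD('n)"
  have r: "0 < r" using b by (simp add: r_def)
  \<comment> \<open>The preimage of a cell of side 2^(-j) stays within r/2^j of one point, so it
    fits into a cube of side 2 r/2^j.\<close>
  define C where "C = (2 * r) ^ CARD('n)"
  have C: "0 < C" using r by (simp add: C_def)
  interpret refining_partition lebesgue "grid_index 1 (0 :: real ^ 'n)"
    by (rule refining_partition_grid) simp
  have cell_le: "emeasure ?\<nu> (cell j x) \<le> ennreal C * emeasure lebesgue (cell j x)" for j and x :: "real ^ 'n"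
  proof -
    obtain a where a: "emeasure lebesgue (cell j x) = ennreal ((1 / 2 ^ j) ^ CARD('n))"
      using grid_cell_in_cube[of 1 0 j x] by auto
    define \<rho> where "\<rho> = r / 2 ^ j"
    have \<rho>: "0 < \<rho>" using r by (simp add: \<rho>_def)
    let ?c = "?B *v x - (\<chi> i. \<rho>)"
    have "(*v) A -` cell j x \<subseteq> cbox ?c (?c + (\<chi> i. 2 * \<rho>))"
      unfolding vimage_matrix_eq[OF assms]
    proof safe
      fix y assume "y \<in> cell j x"
      then have "dist x y \<le> real CARD('n) * (1 / 2 ^ j)"
        using grid_cell_dist[of 1 y 0 j x] by simp
      then have "b * norm (x - y) \<le> b * (real CARD('n) * (1 / 2 ^ j))"
        using b by (intro mult_left_mono) (auto simp: dist_norm)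
      moreover have "norm (?B *v x - ?B *v y) \<le> b * norm (x - y)"
        using b(2)[of "x - y"] by (simp add: matrix_vector_mult_diff_distrib)
      ultimately have "norm (?B *v x - ?B *v y) \<le> \<rho>"
        by (simp add: \<rho>_def r_def)
      then have "\<bar>(?B *v x - ?B *v y) $ i\<bar> \<le> \<rho>" for i
        using component_le_norm_cart order_trans by blast
      then have "\<bar>(?B *v x) $ i - (?B *v y) $ i\<bar> \<le> \<rho>" for i by simp
      then show "?B *v y \<in> cbox ?c (?c + (\<chi> i. 2 * \<rho>))"
        by (auto simp: mem_box_cart abs_le_iff algebra_simps)
    qed
    then have "emeasure lebesgue ((*v) A -` cell j x) \<le> emeasure lebesgue (cbox ?c (?c + (\<chi> i. 2 * \<rho>)))"
      by (rule emeasure_mono) simp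
    also have "\<dots> = ennreal ((2 * \<rho>) ^ CARD('n))" using \<rho> by (intro lebesgue_cube) simp
    also have "(2 * \<rho>) ^ CARD('n) = C * (1 / 2 ^ j) ^ CARD('n)"
      by (simp add: C_def \<rho>_def power_divide)
    also have "ennreal \<dots> = ennreal C * emeasure lebesgue (cell j x)"
      unfolding a using C by (subst ennreal_mult) auto
    finally show ?thesis using cell_sets by (simp add: \<nu> del: emeasure_completion)
  qed
  have open_le: "emeasure ?\<nu> U \<le> ennreal C * emeasure lebesgue U" if "open U" for U
  proof -
    have dens: "emeasure (density lebesgue (\<lambda>_. ennreal C)) S = ennreal C * emeasure lebesgue S"
      if "S \<in> sets lebesgue" for S
      using that by (simp add: emeasure_density nn_integral_cmult_indicator del: emeasure_completion)
    have "{x. \<exists>j. cell j x \<subseteq> U} = U"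
      using that by (intro open_eq_grid_cells) auto
    moreover have "emeasure ?\<nu> {x. \<exists>j. cell j x \<subseteq> U} \<le> emeasure (density lebesgue (\<lambda>_. ennreal C)) {x. \<exists>j. cell j x \<subseteq> U}"
      by (rule stopping_cells_cover) (auto simp: dens cell_sets cell_le simp del: emeasure_completion)
    ultimately show ?thesis using that by (simp add: dens del: emeasure_completion)
  qed
  show ?thesis
  proof (rule that[OF C])
    fix S :: "(real ^ 'n) set" assume S: "S \<in> sets lebesgue"
    \<comment> \<open>Outer regularity carries the bound from open to measurable sets; the error d/C
      becomes \<open>d\<close> after multiplication by \<open>C\<close>.\<close>
    have eps: "emeasure ?\<nu> S \<le> ennreal C * emeasure lebesgue S + ennreal d" if "0 < d" for d
    proof -
      have "0 < d / C" using that C by simp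
      then obtain U where U: "open U" "S \<subseteq> U" "U - S \<in> lmeasurable" "emeasure lebesgue (U - S) < ennreal (d / C)"
        using sets_lebesgue_outer_open[OF S] by blast
      have "emeasure ?\<nu> S \<le> emeasure ?\<nu> U" using U by (intro emeasure_mono) auto
      also have "\<dots> \<le> ennreal C * emeasure lebesgue U" using U by (intro open_le)
      also have "emeasure lebesgue U = emeasure lebesgue S + emeasure lebesgue (U - S)"
        using S U by (subst plus_emeasure) (auto simp: Un_absorb1)
      also have "ennreal C * \<dots> \<le> ennreal C * (emeasure lebesgue S + ennreal (d / C))"
        using U by (intro mult_left_mono add_left_mono) auto
      also have "\<dots> = ennreal C * emeasure lebesgue S + ennreal d"
        using C that by (simp add: distrib_left del: emeasure_completion flip: ennreal_mult)
      finally show ?thesis .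
    qed
    have "emeasure ?\<nu> S \<le> ennreal C * emeasure lebesgue S"
      by (rule ennreal_le_epsilon) (rule eps)
    then show "emeasure lebesgue ((*v) A -` S) \<le> ennreal C * emeasure lebesgue S"
      using S by (simp add: \<nu> del: emeasure_completion)
  qed
qed

text \<open>Read as an order relation between measures, the inequality for sets passes to integrals
  at once.\<close>

lemma nn_integral_matrix_le:
  fixes A :: "real ^ 'n ^ 'n"
  assumes "invertible A"
  obtains C where "0 < C"
    "\<And>f. f \<in> borel_measurable lebesgue \<Longrightarrow> (\<integral>\<^sup>+x. f (A *v x) \<partial>lebesgue) \<le> ennreal C * (\<integral>\<^sup>+x. f x \<partial>lebesgue)"
proof -
  obtain C where C: "0 < C" and le:
    "\<And>S. S \<in> sets lebesgue \<Longrightarrow> emeasure lebesgue ((*v) A -` S) \<le> ennreal C * emeasure lebesgue S"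
    using emeasure_vimage_matrix_le[OF assms] by metis
  note meas = measurable_matrix_lebesgue[OF assms]
  have le': "distr lebesgue lebesgue ((*v) A) \<le> density lebesgue (\<lambda>_. ennreal C)"
    by (subst le_measure)
      (auto simp: le_fun_def emeasure_distr[OF meas] emeasure_density nn_integral_cmult_indicator le emeasure_notin_sets
        simp del: emeasure_completion)
  show ?thesis
  proof (rule that[OF C])
    fix f :: "real ^ 'n \<Rightarrow> ennreal" assume f: "f \<in> borel_measurable lebesgue"
    have "(\<integral>\<^sup>+x. f (A *v x) \<partial>lebesgue) = (\<integral>\<^sup>+x. f x \<partial>distr lebesgue lebesgue ((*v) A))"
      using f by (subst nn_integral_distr[OF meas]) auto
    also have "\<dots> \<le> (\<integral>\<^sup>+x. f x \<partial>density lebesgue (\<lambda>_. ennreal C))"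
      by (rule nn_integral_mono_measure[OF _ le']) simp
    also have "\<dots> = ennreal C * (\<integral>\<^sup>+x. f x \<partial>lebesgue)"
      using f by (simp add: nn_integral_density nn_integral_cmult)
    finally show "(\<integral>\<^sup>+x. f (A *v x) \<partial>lebesgue) \<le> ennreal C * (\<integral>\<^sup>+x. f x \<partial>lebesgue)" .
  qed
qed

lemma AE_matrix_lebesgue:
  fixes A :: "real ^ 'n ^ 'n"
  assumes A: "invertible A" and P: "AE x in lebesgue. P x"
  shows "AE x in lebesgue. P (A *v x)"
proof -
  obtain N where N: "\<And>x. x \<in> space lebesgue - N \<Longrightarrow> P x" "N \<in> null_sets lebesgue"
    using P by (rule AE_E3) blast
  obtain C where C: "emeasure lebesgue ((*v) A -` N) \<le> ennreal C * emeasure lebesgue N"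
    using emeasure_vimage_matrix_le[OF A] N by (metis null_setsD2)
  have "(*v) A -` N \<in> sets lebesgue"
    using measurable_sets[OF measurable_matrix_lebesgue[OF A], of N] N by auto
  moreover have "emeasure lebesgue ((*v) A -` N) = 0"
    using C null_setsD1[OF N(2)] by (simp del: emeasure_completion)
  ultimately have "(*v) A -` N \<in> null_sets lebesgue" by (rule null_setsI[rotated])
  from AE_not_in[OF this] show ?thesis by eventually_elim (use N(1) in auto)
qed

lemma AE_matrix_power_le:
  fixes A :: "real ^ 'n ^ 'n" and w :: "real ^ 'n \<Rightarrow> real"
  assumes A: "invertible A" and "0 < c" and le: "AE x in lebesgue. w (A *v x) \<le> c * w x"
  shows "AE x in lebesgue. w (matrix_power A m *v x) \<le> c ^ m * w x"
proof (induction m)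
  case (Suc m)
  have comm: "matrix_power A m ** A = A ** matrix_power A m" for m
    by (induction m) (auto simp: matrix_mul_assoc[symmetric])
  from AE_matrix_lebesgue[OF A Suc.IH] le show ?case
  proof eventually_elim
    case (elim x)
    have "w (matrix_power A (Suc m) *v x) = w (matrix_power A m *v (A *v x))"
      by (simp add: matrix_vector_mul_assoc comm)
    also have "\<dots> \<le> c ^ m * w (A *v x)" by (rule elim)
    also have "\<dots> \<le> c ^ m * (c * w x)"
      using elim \<open>0 < c\<close> by (intro mult_left_mono) auto
    finally show ?case by (simp add: mult_ac)
  qed
qed simp

text \<open>Since A^(k - 1) inverts \<open>A\<close>, iterating the inequality k - 1 times from A x
  leads back to x. Exceptional sets stay null along the way because \<open>A\<close> preserves null
  sets.\<close>

lemma AE_le_matrix: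
  fixes A :: "real ^ 'n ^ 'n" and w :: "real ^ 'n \<Rightarrow> real"
  assumes A: "invertible A" "1 \<le> k" "matrix_power A k = mat 1"
    and "0 < c" and le: "AE x in lebesgue. w (A *v x) \<le> c * w x"
  shows "AE x in lebesgue. w x \<le> c ^ (k - 1) * w (A *v x)"
proof -
  have comm: "matrix_power A m ** A = A ** matrix_power A m" for m
    by (induction m) (auto simp: matrix_mul_assoc[symmetric])
  have "matrix_power A (k - 1) ** A = mat 1"
    using A comm[of "k - 1"] by (cases k) auto
  then have "matrix_power A (k - 1) *v (A *v x) = x" for x
    by (simp add: matrix_vector_mul_assoc)
  then show ?thesis
    using AE_matrix_lebesgue[OF A(1) AE_matrix_power_le[OF A(1) \<open>0 < c\<close> le, of "k - 1"]] by simp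
qed

section \<open>Cubes, averages and the weight constant\<close>

lemma cubes_cases:
  assumes "Q \<in> cubes"
  obtains a l where "0 < l" "Q = cbox a (a + (\<chi> i. l))"
  using assms by (auto simp: cubes_def)

lemma cubes_measure:
  fixes Q :: "(real ^ 'n) set"
  assumes "Q \<in> cubes"
  obtains m where "0 < m" "emeasure lebesgue Q = ennreal m" "measure lebesgue Q = m" "Q \<in> sets lebesgue"
proof -
  obtain a l where al: "0 < l" "Q = cbox a (a + (\<chi> i. l))" using assms by (rule cubes_cases)
  have "emeasure lebesgue Q = ennreal (l ^ CARD('n))"
    using al lebesgue_cube(1)[of l a] by simp
  moreover from this have "measure lebesgue Q = l ^ CARD('n)"
    using al by (simp add: measure_def)
  ultimately show ?thesis using al by (intro that[of "l ^ CARD('n)"]) auto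
qed

text \<open>If \<open>E\<close> filled less than half of every cube, then so would a bounded part F
  of positive measure; summing over the cells inside an open \<open>U\<close> containing F gives 2
  |F| \<le> |U|. Outer regularity provides such a \<open>U\<close> with |U| < 2 |F|.\<close>

lemma positive_measure_dense_in_cube:
  fixes E :: "(real ^ 'n) set"
  assumes E: "E \<in> sets lebesgue" "emeasure lebesgue E \<noteq> 0"
  obtains Q where "Q \<in> cubes" "emeasure lebesgue Q \<le> 2 * emeasure lebesgue (E \<inter> Q)"
proof -
  have sets: "E \<inter> ball 0 (real R) \<in> sets lebesgue" for R
    by (rule sets.Int[OF E(1)]) simp
  have "\<exists>R. emeasure lebesgue (E \<inter> ball 0 (real R)) \<noteq> 0"
  proof (rule ccontr)
    assume "\<not> ?thesis"
    then have "(\<Union>R. E \<inter> ball 0 (real R)) \<in> null_sets lebesgue"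
      using sets by (intro null_sets_UN null_setsI) (auto simp del: emeasure_completion)
    moreover have "(\<Union>R. E \<inter> ball 0 (real R)) = E"
      using reals_Archimedean2 by auto
    ultimately show False using E null_setsD1 by auto
  qed
  then obtain R where R: "emeasure lebesgue (E \<inter> ball 0 (real R)) \<noteq> 0" by blast
  define F where "F = E \<inter> ball 0 (real R)"
  have F: "F \<in> sets lebesgue" unfolding F_def by (rule sets)
  have "F \<in> lmeasurable"
    by (intro bounded_set_imp_lmeasurable F) (auto simp: F_def)
  then obtain d where d: "emeasure lebesgue F = ennreal d" "0 < d"
    using R by (cases "emeasure lebesgue F") (auto simp: F_def fmeasurable_def order_less_le)
  obtain U where U: "open U" "F \<subseteq> U" "U - F \<in> lmeasurable" "emeasure lebesgue (U - F) < ennreal d"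
    using sets_lebesgue_outer_open[OF F d(2)] by blast
  interpret refining_partition lebesgue "grid_index 1 (0 :: real ^ 'n)"
    by (rule refining_partition_grid) simp
  show ?thesis
  proof (rule ccontr)
    assume "\<not> thesis"
    with that have small: "2 * emeasure lebesgue (E \<inter> Q) \<le> emeasure lebesgue Q" if "Q \<in> cubes" for Q
      using \<open>Q \<in> cubes\<close> by (meson linear)
    have "emeasure (density lebesgue (\<lambda>x. 2 * indicator F x)) {x. \<exists>j. cell j x \<subseteq> U}
        \<le> emeasure lebesgue {x. \<exists>j. cell j x \<subseteq> U}"
    proof (rule stopping_cells_cover)
      fix j and x :: "real ^ 'n"
      obtain a where a: "cell j x \<subseteq> cbox a (a + (\<chi> i. 1 / 2 ^ j))"
        "emeasure lebesgue (cell j x) = ennreal ((1 / 2 ^ j) ^ CARD('n))"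
        using grid_cell_in_cube[of 1 0 j x] by auto
      let ?Q = "cbox a (a + (\<chi> i. 1 / 2 ^ j))"
      have "?Q \<in> cubes" unfolding cubes_def by (auto intro!: exI[of _ a] exI[of _ "1 / 2 ^ j"])
      have "emeasure (density lebesgue (\<lambda>x. 2 * indicator F x)) (cell j x) = 2 * emeasure lebesgue (F \<inter> cell j x)"
        using F cell_sets[of j x]
        by (subst emeasure_density)
          (auto simp: mult.assoc nn_integral_cmult indicator_inter_arith[symmetric])
      also have "\<dots> \<le> 2 * emeasure lebesgue (E \<inter> ?Q)"
        using a E by (intro mult_left_mono emeasure_mono) (auto simp: F_def)
      also have "\<dots> \<le> emeasure lebesgue ?Q" by (rule small) fact
      also have "\<dots> = emeasure lebesgue (cell j x)"
        using a lebesgue_cube(1)[of "1 / 2 ^ j" a] by simp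
      finally show "emeasure (density lebesgue (\<lambda>x. 2 * indicator F x)) (cell j x) \<le> emeasure lebesgue (cell j x)" .
    qed auto
    moreover have "{x. \<exists>j. cell j x \<subseteq> U} = U"
      using U by (intro open_eq_grid_cells) auto
    moreover have "emeasure (density lebesgue (\<lambda>x. 2 * indicator F x)) U = 2 * emeasure lebesgue F"
    proof -
      have "F \<inter> U = F" using U by auto
      then show ?thesis using F U
        by (subst emeasure_density)
          (auto simp: mult.assoc nn_integral_cmult indicator_inter_arith[symmetric])
    qed
    ultimately have "2 * emeasure lebesgue F \<le> emeasure lebesgue U" by simp
    also have "\<dots> = emeasure lebesgue F + emeasure lebesgue (U - F)"
      using F U by (subst plus_emeasure) (auto simp: Un_absorb1)
    also have "\<dots> < emeasure lebesgue F + ennreal d"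
      using U(4) d by (simp add: ennreal_add_left_cancel_less)
    also have "\<dots> = 2 * emeasure lebesgue F"
      using d by (simp flip: mult_2)
    finally show False by simp
  qed
qed

lemma conj_exp:
  assumes "1 < p"
  shows "1 / p + 1 / conj_exp p = 1" "0 < conj_exp p"
  using assms by (auto simp: conj_exp_def field_simps)

text \<open>Raising to the power \<open>q\<close> and multiplying by m^(1 + q/p') clears the
  averages. The cleared form is the one that \<open>frac_maxfun_bound\<close> takes on
  cells.\<close>

lemma avg_norm_mult_le_iff:
  fixes f g :: "real ^ 'n \<Rightarrow> real"
  assumes Q: "emeasure lebesgue Q = ennreal m" "0 < m" and "0 < q" "0 < p'" "0 \<le> k"
  shows "avg_norm q Q f * avg_norm p' Q g \<le> ennreal k \<longleftrightarrow>
    (\<integral>\<^sup>+x\<in>Q. ennreal (\<bar>f x\<bar> powr q) \<partial>lebesgue) * epowr (\<integral>\<^sup>+x\<in>Q. ennreal (\<bar>g x\<bar> powr p') \<partial>lebesgue) (q / p')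
      \<le> ennreal (k powr q) * epowr (emeasure lebesgue Q) (q * (1 / q + 1 / p'))"
proof -
  define U where "U = (\<integral>\<^sup>+x\<in>Q. ennreal (\<bar>f x\<bar> powr q) \<partial>lebesgue)"
  define S where "S = (\<integral>\<^sup>+x\<in>Q. ennreal (\<bar>g x\<bar> powr p') \<partial>lebesgue)"
  define a b where "a = U / ennreal m" and "b = S / ennreal m"
  have U: "U = a * ennreal m" and S: "S = b * ennreal m"
    using Q by (simp_all add: a_def b_def ennreal_divide_times mult_divide_eq_ennreal)
  have "avg_norm q Q f * avg_norm p' Q g = epowr a (1 / q) * epowr b (1 / p')"
    unfolding avg_norm_def Q a_def b_def U_def S_def ..
  moreover have "epowr a (1 / q) * epowr b (1 / p') \<le> ennreal k \<longleftrightarrow> a * epowr b (q / p') \<le> ennreal (k powr q)"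
    using epowr_le_iff[of "1 / q" "a * epowr b (q / p')" "ennreal k"] assms
    by (simp add: epowr_mult epowr_epowr epowr_ennreal)
  moreover have "U * epowr S (q / p') = a * epowr b (q / p') * ennreal (m powr (q * (1 / q + 1 / p')))"
  proof -
    have "U * epowr S (q / p') = a * epowr b (q / p') * (ennreal m * ennreal (m powr (q / p')))"
      using Q by (simp add: U S epowr_mult epowr_ennreal ac_simps)
    also have "ennreal m * ennreal (m powr (q / p')) = ennreal (m powr (1 + q / p'))"
      using Q by (simp add: powr_add flip: ennreal_mult)
    also have "1 + q / p' = q * (1 / q + 1 / p')"
      using assms by (simp add: field_simps)
    finally show ?thesis .
  qed
  moreover have "x * ennreal d \<le> y * ennreal d \<longleftrightarrow> x \<le> y" if "0 < d" for x y d
    using that by (subst (1 2) mult.commute) (simp add: ennreal_mult_le_mult_iff)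
  then have "a * epowr b (q / p') * ennreal (m powr (q * (1 / q + 1 / p')))
     \<le> ennreal (k powr q) * ennreal (m powr (q * (1 / q + 1 / p'))) \<longleftrightarrow> a * epowr b (q / p') \<le> ennreal (k powr q)"
    using Q by simp
  ultimately show ?thesis using Q by (simp add: epowr_ennreal U_def S_def)
qed

lemma avg_norm_cong_AE:
  assumes "AE x in lebesgue. f x = g x"
  shows "avg_norm r Q f = avg_norm r Q g"
proof -
  have "(\<integral>\<^sup>+x\<in>Q. ennreal (\<bar>f x\<bar> powr r) \<partial>lebesgue) = (\<integral>\<^sup>+x\<in>Q. ennreal (\<bar>g x\<bar> powr r) \<partial>lebesgue)"
    using assms by (intro nn_integral_cong_AE) auto
  then show ?thesis by (simp add: avg_norm_def)
qed

lemma avg_norm_le_cmult: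
  assumes g: "g \<in> borel_measurable lebesgue"
    and le: "AE x in lebesgue. \<bar>f x\<bar> \<le> c * \<bar>g x\<bar>" and Q: "Q \<in> sets lebesgue" and "0 < r" "0 \<le> c"
  shows "avg_norm r Q f \<le> ennreal c * avg_norm r Q g"
proof -
  have "(\<integral>\<^sup>+x\<in>Q. ennreal (\<bar>f x\<bar> powr r) \<partial>lebesgue)
     \<le> (\<integral>\<^sup>+x. ennreal (c powr r) * (ennreal (\<bar>g x\<bar> powr r) * indicator Q x) \<partial>lebesgue)"
  proof (rule nn_integral_mono_AE)
    show "AE x in lebesgue. ennreal (\<bar>f x\<bar> powr r) * indicator Q x \<le> ennreal (c powr r) * (ennreal (\<bar>g x\<bar> powr r) * indicator Q x)"
      using le
    proof eventually_elim
      case (elim x)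
      have "\<bar>f x\<bar> powr r \<le> c powr r * \<bar>g x\<bar> powr r"
        using powr_mono2[OF _ _ elim, of r] assms by (simp add: powr_mult)
      then show ?case by (auto simp: ennreal_leI split: split_indicator simp flip: ennreal_mult)
    qed
  qed
  also have "\<dots> = ennreal (c powr r) * (\<integral>\<^sup>+x\<in>Q. ennreal (\<bar>g x\<bar> powr r) \<partial>lebesgue)"
    using g Q by (intro nn_integral_cmult) auto
  finally have "epowr ((\<integral>\<^sup>+x\<in>Q. ennreal (\<bar>f x\<bar> powr r) \<partial>lebesgue) / emeasure lebesgue Q) (1 / r)
      \<le> epowr (ennreal (c powr r) * ((\<integral>\<^sup>+x\<in>Q. ennreal (\<bar>g x\<bar> powr r) \<partial>lebesgue) / emeasure lebesgue Q)) (1 / r)"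
    using \<open>0 < r\<close> by (intro epowr_mono) (auto simp: ennreal_times_divide intro: divide_right_mono_ennreal)
  then show ?thesis
    using assms by (simp add: avg_norm_def epowr_mult epowr_ennreal powr_powr)
qed

lemma Apq_const_le_cmult:
  fixes A B :: "real ^ 'n ^ 'n"
  assumes "(\<lambda>x. w (B *v x)) \<in> borel_measurable lebesgue"
    and "AE x in lebesgue. \<bar>w (A *v x)\<bar> \<le> c * \<bar>w (B *v x)\<bar>" "0 < q" "0 \<le> c"
  shows "Apq_const A p q w \<le> ennreal c * Apq_const B p q w"
  unfolding Apq_const_def SUP_mult_left_ennreal
proof (rule SUP_mono)
  fix Q :: "(real ^ 'n) set" assume Q: "Q \<in> cubes"
  then have "Q \<in> sets lebesgue" by (rule cubes_measure)
  from avg_norm_le_cmult[OF assms(1,2) this assms(3,4)] Q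
  show "\<exists>R\<in>cubes. avg_norm q Q (\<lambda>x. w (A *v x)) * avg_norm (conj_exp p) Q (\<lambda>x. inverse (w x))
     \<le> ennreal c * (avg_norm q R (\<lambda>x. w (B *v x)) * avg_norm (conj_exp p) R (\<lambda>x. inverse (w x)))"
    by (intro bexI[of _ Q]) (auto simp: mult.assoc[symmetric] intro: mult_right_mono)
qed

lemma Apq_const_finite_imp_AE_le:
  fixes A :: "real ^ 'n ^ 'n" and w :: "real ^ 'n \<Rightarrow> real"
  assumes A: "invertible A" and w: "weight w" and p: "1 < p" "0 < q"
    and fin: "Apq_const A p q w < \<infinity>"
  shows "\<exists>c>0. AE x in lebesgue. w (A *v x) \<le> c * w x"
proof -
  have [measurable]: "w \<in> borel_measurable lebesgue" and pos: "AE x in lebesgue. 0 < w x"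
    using w by (auto simp: weight_def)
  have [measurable]: "(\<lambda>x. w (A *v x)) \<in> borel_measurable lebesgue"
    by (rule measurable_compose[OF measurable_matrix_lebesgue[OF A]]) measurable
  define p' where "p' = conj_exp p"
  have p': "0 < p'" using conj_exp[OF p(1)] by (simp add: p'_def)
  define s where "s = 1 / q + 1 / p'"
  have s: "0 < s" using p p' by (simp add: s_def add_pos_pos)
  obtain k where k: "0 \<le> k" "Apq_const A p q w = ennreal k"
    using fin by (cases "Apq_const A p q w") auto
  \<comment> \<open>Filling only half a cube costs a factor 2^s in the product of norms, so
    \<open>k * 2 powr s\<close> is the threshold; the added 1 makes the contradiction strict and
    keeps \<open>c\<close> positive.\<close>
  define c where "c = k * 2 powr s + 1"
  have c: "0 < c" using k by (simp add: c_def add_nonneg_pos)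
  \<comment> \<open>A fixed threshold \<open>t\<close> turns both values of \<open>w\<close> into
    constant bounds on the test set \<open>E\<close>; rational thresholds suffice, so only countably
    many null sets arise.\<close>
  have null: "AE x in lebesgue. \<not> (0 < w x \<and> w x < t \<and> c * t < w (A *v x))" if "0 < t" for t
  proof -
    define E where "E = {x. 0 < w x \<and> w x < t \<and> c * t < w (A *v x)}"
    have E: "E \<in> sets lebesgue"
    proof -
      have "{x \<in> space lebesgue. 0 < w x \<and> w x < t \<and> c * t < w (A *v x)} \<in> sets lebesgue" by measurable
      then show ?thesis by (simp add: E_def)
    qed
    have "emeasure lebesgue E = 0"
    proof (rule ccontr)
      assume "emeasure lebesgue E \<noteq> 0"
      then obtain Q where Q: "Q \<in> cubes" "emeasure lebesgue Q \<le> 2 * emeasure lebesgue (E \<inter> Q)"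
        using positive_measure_dense_in_cube[OF E] by blast
      obtain m where m: "0 < m" "emeasure lebesgue Q = ennreal m" "Q \<in> sets lebesgue"
        using cubes_measure[OF Q(1)] by metis
      have half: "ennreal (m / 2) \<le> emeasure lebesgue (E \<inter> Q)"
      proof -
        have "ennreal 2 * ennreal (m / 2) = ennreal m"
          using m by (subst ennreal_mult[symmetric]) auto
        then have "ennreal 2 * ennreal (m / 2) \<le> ennreal 2 * emeasure lebesgue (E \<inter> Q)"
          using Q m by simp
        then show ?thesis by (subst (asm) ennreal_mult_le_mult_iff) auto
      qed
      have lower: "ennreal (d * (m / 2)) \<le> (\<integral>\<^sup>+x\<in>Q. ennreal (h x) \<partial>lebesgue)"
        if "\<And>x. x \<in> E \<Longrightarrow> d \<le> h x" "0 \<le> d" for d h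
      proof -
        have "ennreal (d * (m / 2)) \<le> ennreal d * emeasure lebesgue (E \<inter> Q)"
          unfolding ennreal_mult'[OF that(2)] by (intro mult_left_mono half) simp
        also have "\<dots> = (\<integral>\<^sup>+x. ennreal d * indicator (E \<inter> Q) x \<partial>lebesgue)"
          using E m by (subst nn_integral_cmult_indicator) auto
        also have "\<dots> \<le> (\<integral>\<^sup>+x\<in>Q. ennreal (h x) \<partial>lebesgue)"
          using that by (intro nn_integral_mono) (auto split: split_indicator intro: ennreal_leI)
        finally show ?thesis .
      qed
      have 1: "ennreal ((c * t) powr q * (m / 2)) \<le> (\<integral>\<^sup>+x\<in>Q. ennreal (\<bar>w (A *v x)\<bar> powr q) \<partial>lebesgue)"
        using c \<open>0 < t\<close> p by (intro lower powr_mono2) (auto simp: E_def)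
      have 2: "ennreal (inverse t powr p' * (m / 2)) \<le> (\<integral>\<^sup>+x\<in>Q. ennreal (\<bar>inverse (w x)\<bar> powr p') \<partial>lebesgue)"
        using p' \<open>0 < t\<close> by (intro lower powr_mono2) (auto simp: E_def intro: le_imp_inverse_le)
      have "avg_norm q Q (\<lambda>x. w (A *v x)) * avg_norm p' Q (\<lambda>x. inverse (w x)) \<le> ennreal k"
        unfolding k(2)[symmetric] Apq_const_def p'_def by (rule SUP_upper[OF Q(1)])
      then have upper: "(\<integral>\<^sup>+x\<in>Q. ennreal (\<bar>w (A *v x)\<bar> powr q) \<partial>lebesgue) *
          epowr (\<integral>\<^sup>+x\<in>Q. ennreal (\<bar>inverse (w x)\<bar> powr p') \<partial>lebesgue) (q / p') \<le> ennreal (k powr q * m powr (q * s))"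
        using avg_norm_mult_le_iff[OF m(2,1) p(2) p' k(1)] m by (simp add: s_def epowr_ennreal ennreal_mult)
      have "ennreal ((c * t) powr q * (m / 2)) * epowr (ennreal (inverse t powr p' * (m / 2))) (q / p')
        \<le> (\<integral>\<^sup>+x\<in>Q. ennreal (\<bar>w (A *v x)\<bar> powr q) \<partial>lebesgue) *
          epowr (\<integral>\<^sup>+x\<in>Q. ennreal (\<bar>inverse (w x)\<bar> powr p') \<partial>lebesgue) (q / p')"
        using 1 2 p p' by (intro mult_mono epowr_mono) auto
      from order_trans[OF this upper]
      have "ennreal ((c * t) powr q * (m / 2) * (inverse t powr p' * (m / 2)) powr (q / p'))
         \<le> ennreal (k powr q * m powr (q * s))"
        using m by (subst (asm) ennreal_mult_epowr) auto
      then have "(c * t) powr q * (m / 2) * (inverse t powr p' * (m / 2)) powr (q / p') \<le> k powr q * m powr (q * s)"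
        by (subst (asm) ennreal_le_iff) auto
      moreover have "(c * t) powr q * (m / 2) * (inverse t powr p' * (m / 2)) powr (q / p')
         = c powr q * ((m / 2) powr 1 * (m / 2) powr (q / p'))"
      proof -
        have "(inverse t powr p' * (m / 2)) powr (q / p') = inverse t powr q * (m / 2) powr (q / p')"
          unfolding powr_mult powr_powr using p' by simp
        moreover have "t powr q * inverse t powr q = 1"
          using \<open>0 < t\<close> by (simp flip: powr_mult)
        ultimately show ?thesis
          using m by (simp add: powr_mult)
      qed
      moreover have "(m / 2) powr 1 * (m / 2) powr (q / p') = (m / 2) powr (q * s)"
      proof -
        have "q * s = 1 + q / p'" using p by (simp add: s_def distrib_left)
        then show ?thesis by (simp only: powr_add)
      qed
      ultimately have "c powr q * (m / 2) powr (q * s) \<le> k powr q * m powr (q * s)" by simp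
      also have "m powr (q * s) = (2 powr s) powr q * (m / 2) powr (q * s)"
        using m by (simp add: powr_powr powr_divide mult.commute)
      finally have "c powr q \<le> (k * 2 powr s) powr q"
        using m k by (simp add: powr_mult mult.assoc[symmetric])
      moreover have "(k * 2 powr s) powr q < c powr q"
        using k p by (intro powr_less_mono2) (auto simp: c_def)
      ultimately show False by simp
    qed
    with E have "E \<in> null_sets lebesgue" by auto
    then show ?thesis by (auto dest: AE_not_in simp: E_def)
  qed
  have "AE x in lebesgue. \<forall>t\<in>\<rat>. 0 < t \<longrightarrow> \<not> (0 < w x \<and> w x < t \<and> c * t < w (A *v x))"
    using null by (subst AE_ball_countable[OF countable_rat]) auto
  with pos have "AE x in lebesgue. w (A *v x) \<le> c * w x"
  proof eventually_elim
    case (elim x)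
    show ?case
    proof (rule ccontr)
      assume "\<not> ?thesis"
      then have "w x < w (A *v x) / c" using c by (simp add: field_simps)
      then obtain t where "t \<in> \<rat>" "w x < t" "t < w (A *v x) / c" using Rats_dense_in_real by blast
      with elim c show False by (auto simp: field_simps)
    qed
  qed
  with c show ?thesis by blast
qed

lemma Apq_class_mat_eq:
  fixes A :: "real ^ 'n ^ 'n"
  assumes A: "invertible A" "1 \<le> k" "matrix_power A k = mat 1" and p: "1 < p" "0 < q"
  shows "Apq_class_mat A p q = {w \<in> Apq_class p q. \<exists>C>0. AE x in lebesgue. w (A *v x) \<le> C * w x}"
proof -
  have meas: "w \<in> borel_measurable lebesgue" "(\<lambda>x. w (A *v x)) \<in> borel_measurable lebesgue"
    and pos: "AE x in lebesgue. 0 < w x" "AE x in lebesgue. 0 < w (A *v x)" if "weight w" for w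
  proof -
    show *: "w \<in> borel_measurable lebesgue" "AE x in lebesgue. 0 < w x"
      using that by (auto simp: weight_def)
    show "(\<lambda>x. w (A *v x)) \<in> borel_measurable lebesgue"
      by (rule measurable_compose[OF measurable_matrix_lebesgue[OF A(1)] *(1)])
    show "AE x in lebesgue. 0 < w (A *v x)"
      by (rule AE_matrix_lebesgue[OF A(1) *(2)])
  qed
  \<comment> \<open>Used in both directions: from \<open>A\<close> to the identity with constant
    \<open>c ^ (k - 1)\<close>, and back with \<open>c\<close>.\<close>
  have trans: "Apq_const B p q w < \<infinity>"
    if "Apq_const C p q w < \<infinity>" "0 < c" "AE x in lebesgue. \<bar>w (B *v x)\<bar> \<le> c * \<bar>w (C *v x)\<bar>"
      "(\<lambda>x. w (C *v x)) \<in> borel_measurable lebesgue"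
    for B C :: "real ^ 'n ^ 'n" and c w
  proof -
    have "Apq_const B p q w \<le> ennreal c * Apq_const C p q w"
      using that p by (intro Apq_const_le_cmult) auto
    also have "\<dots> < \<infinity>"
      using that by (simp add: ennreal_mult_less_top)
    finally show ?thesis .
  qed
  show ?thesis
  proof (intro set_eqI iffI)
    fix w assume "w \<in> Apq_class_mat A p q"
    then have w: "weight w" "Apq_const A p q w < \<infinity>" by (auto simp: Apq_class_mat_def)
    obtain c where c: "0 < c" "AE x in lebesgue. w (A *v x) \<le> c * w x"
      using Apq_const_finite_imp_AE_le[OF A(1) w(1) p w(2)] by blast
    have "AE x in lebesgue. w x \<le> c ^ (k - 1) * w (A *v x)"
      by (rule AE_le_matrix[OF A c])
    then have "AE x in lebesgue. \<bar>w (mat 1 *v x)\<bar> \<le> c ^ (k - 1) * \<bar>w (A *v x)\<bar>"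
      using pos[OF w(1)] by eventually_elim auto
    then have "Apq_const (mat 1) p q w < \<infinity>"
      using c meas[OF w(1)] by (intro trans[OF w(2)]) auto
    with w c show "w \<in> {w \<in> Apq_class p q. \<exists>C>0. AE x in lebesgue. w (A *v x) \<le> C * w x}"
      by (auto simp: Apq_class_def Apq_class_mat_def)
  next
    fix w assume "w \<in> {w \<in> Apq_class p q. \<exists>C>0. AE x in lebesgue. w (A *v x) \<le> C * w x}"
    then obtain c where w: "weight w" "Apq_const (mat 1) p q w < \<infinity>"
      and c: "0 < c" "AE x in lebesgue. w (A *v x) \<le> c * w x"
      by (auto simp: Apq_class_def Apq_class_mat_def)
    from c(2) pos[OF w(1)] have "AE x in lebesgue. \<bar>w (A *v x)\<bar> \<le> c * \<bar>w (mat 1 *v x)\<bar>"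
      by eventually_elim auto
    then have "Apq_const A p q w < \<infinity>"
      using c meas[OF w(1)] by (intro trans[OF w(2)]) auto
    with w show "w \<in> Apq_class_mat A p q" by (auto simp: Apq_class_mat_def)
  qed
qed

section \<open>Boundedness of the maximal operator\<close>

abbreviation grid_frac_maxfun :: "real \<Rightarrow> real ^ 'n \<Rightarrow> real \<Rightarrow> (real ^ 'n \<Rightarrow> ennreal) \<Rightarrow> real ^ 'n \<Rightarrow> ennreal" where
  "grid_frac_maxfun L t \<equiv> refining_partition.frac_maxfun lebesgue (grid_index L t)"

text \<open>Passing to the surrounding cell increases the integral and, as its side is at most 6 l,
  the denominator by a factor of at most (6^n)^s.\<close>

lemma frac_average_le_grid:
  fixes x :: "real ^ 'n" and F :: "real ^ 'n \<Rightarrow> ennreal"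
  assumes "0 < l" "3 * l < L" "x \<in> cbox a (a + (\<chi> i. l))" "0 < s"
  obtains t where "\<And>i. t $ i \<in> {0, L / 3}"
    "(\<integral>\<^sup>+y\<in>cbox a (a + (\<chi> i. l)). F y \<partial>lebesgue) / ennreal ((l ^ CARD('n)) powr s)
       \<le> ennreal ((6 ^ CARD('n)) powr s) * grid_frac_maxfun L t s F x"
proof -
  let ?Q = "cbox a (a + (\<chi> i. l))"
  have L: "0 < L" using assms by simp
  obtain t j where t: "\<And>i. t $ i \<in> {0, L / 3}" and Q: "?Q \<subseteq> grid_cell L t j x" and le: "L / 2 ^ j \<le> 6 * l"
    using cube_in_shifted_grid_cell[OF assms(1-3)] by blast
  obtain m where m: "emeasure lebesgue (grid_cell L t j x) = ennreal m" "m = (L / 2 ^ j) ^ CARD('n)"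
    using grid_cell_in_cube[OF L, of t j x] by metis
  have m0: "0 < m" using L m by simp
  have "m \<le> (6 * l) ^ CARD('n)" unfolding m(2) using L le by (intro power_mono) auto
  then have "m powr s \<le> ((6 * l) ^ CARD('n)) powr s" using m0 \<open>0 < s\<close> by (intro powr_mono2) auto
  then have ms: "m powr s \<le> (6 ^ CARD('n)) powr s * (l ^ CARD('n)) powr s"
    using assms by (simp add: power_mult_distrib powr_mult)
  define d z where "d = (6 ^ CARD('n) :: real) powr s" and "z = (l ^ CARD('n)) powr s"
  have d: "0 < d" "0 < z" using assms by (auto simp: d_def z_def)
  have "(\<integral>\<^sup>+y\<in>?Q. F y \<partial>lebesgue) / ennreal z \<le> (\<integral>\<^sup>+y\<in>grid_cell L t j x. F y \<partial>lebesgue) / ennreal z"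
    using Q by (intro divide_right_mono_ennreal nn_integral_mono) (auto split: split_indicator)
  also have "\<dots> \<le> (\<integral>\<^sup>+y\<in>grid_cell L t j x. F y \<partial>lebesgue) * (ennreal d * inverse (ennreal (m powr s)))"
  proof -
    have "inverse z \<le> d * inverse (m powr s)"
      using ms m0 d by (simp add: d_def[symmetric] z_def[symmetric] field_simps)
    then have "inverse (ennreal z) \<le> ennreal d * inverse (ennreal (m powr s))"
      using d m0 by (simp add: inverse_ennreal ennreal_leI flip: ennreal_mult)
    then show ?thesis unfolding divide_ennreal_def by (intro mult_left_mono) auto
  qed
  also have "\<dots> = ennreal d * ((\<integral>\<^sup>+y\<in>grid_cell L t j x. F y \<partial>lebesgue) / epowr (emeasure lebesgue (grid_cell L t j x)) s)"
    unfolding m(1) using m0 by (simp add: epowr_ennreal divide_ennreal_def mult_ac)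
  also have "\<dots> \<le> ennreal d * grid_frac_maxfun L t s F x"
    unfolding refining_partition.frac_maxfun_def[OF refining_partition_grid[OF L]]
    by (intro mult_left_mono SUP_upper) auto
  finally show ?thesis using t by (intro that) (auto simp: d_def z_def)
qed

text \<open>The grids attached to different \<open>N\<close> are not nested, so the passage to arbitrarily large cubes
  goes through the limes inferior, which also provides a measurable majorant.\<close>

lemma frac_maximal_le_liminf:
  fixes x :: "real ^ 'n"
  assumes s: "s = 1 - \<alpha> / real CARD('n)" "0 < s" and "0 < q"
  shows "epowr (frac_maximal \<alpha> f x) q \<le> ennreal (((6 ^ CARD('n)) powr s) powr q) *
    liminf (\<lambda>N. \<Sum>I\<in>UNIV. epowr (grid_frac_maxfun (2 ^ N) (\<chi> i. if i \<in> I then 2 ^ N / 3 else 0) s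
      (\<lambda>y. ennreal \<bar>f y\<bar>) x) q)" (is "_ \<le> ennreal ?D * liminf ?H")
proof -
  have D: "0 < ?D" by simp
  have "epowr ((\<integral>\<^sup>+y\<in>Q. ennreal \<bar>f y\<bar> \<partial>lebesgue) / ennreal (measure lebesgue Q powr s)) q \<le> ennreal ?D * liminf ?H"
    if Q: "Q \<in> cubes" "x \<in> Q" for Q
  proof -
    obtain a l where l: "0 < l" and Q_eq: "Q = cbox a (a + (\<chi> i. l))" using Q(1) by (rule cubes_cases)
    have "measure lebesgue Q = l ^ CARD('n)"
      using lebesgue_cube(1)[OF l, of a] l by (simp add: Q_eq measure_def)
    define X where "X = epowr ((\<integral>\<^sup>+y\<in>Q. ennreal \<bar>f y\<bar> \<partial>lebesgue) / ennreal (measure lebesgue Q powr s)) q"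
    \<comment> \<open>How large the grid must be depends on the cube, so no single \<open>N\<close>
      serves them all; the liminf does.\<close>
    obtain N0 where N0: "3 * l < 2 ^ N0"
      using real_arch_pow[of 2 "3 * l"] by auto
    have "X \<le> ennreal ?D * ?H N" if "N0 \<le> N" for N
    proof -
      have "(2::real) ^ N0 \<le> 2 ^ N" using that by simp
      then have "3 * l < 2 ^ N" using N0 by linarith
      then obtain t where t: "\<And>i. t $ i \<in> {0, 2 ^ N / 3}"
        and le: "(\<integral>\<^sup>+y\<in>Q. ennreal \<bar>f y\<bar> \<partial>lebesgue) / ennreal ((l ^ CARD('n)) powr s)
          \<le> ennreal ((6 ^ CARD('n)) powr s) * grid_frac_maxfun (2 ^ N) t s (\<lambda>y. ennreal \<bar>f y\<bar>) x"
        using frac_average_le_grid[OF l \<open>3 * l < 2 ^ N\<close> Q(2)[unfolded Q_eq] s(2), of "\<lambda>y. ennreal \<bar>f y\<bar>"]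
        unfolding Q_eq by blast
      \<comment> \<open>The set of shifted coordinates names the translate, so the sum over all
        \<open>I\<close> dominates whichever grid was chosen.\<close>
      define I where "I = {i. t $ i = 2 ^ N / 3}"
      have t_eq: "t = (\<chi> i. if i \<in> I then 2 ^ N / 3 else 0)"
        unfolding vec_eq_iff I_def using t by force
      have "X \<le> epowr (ennreal ((6 ^ CARD('n)) powr s) * grid_frac_maxfun (2 ^ N) t s (\<lambda>y. ennreal \<bar>f y\<bar>) x) q"
        using le \<open>0 < q\<close> \<open>measure lebesgue Q = l ^ CARD('n)\<close> by (auto simp: X_def intro: epowr_mono)
      also have "\<dots> = ennreal ?D * epowr (grid_frac_maxfun (2 ^ N) t s (\<lambda>y. ennreal \<bar>f y\<bar>) x) q"
        by (simp add: epowr_mult epowr_ennreal)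
      also have "\<dots> \<le> ennreal ?D * ?H N"
        unfolding t_eq by (intro mult_left_mono member_le_sum) auto
      finally show ?thesis .
    qed
    then have "X / ennreal ?D \<le> ?H N" if "N0 \<le> N" for N
      using that D by (auto simp: divide_le_posI_ennreal mult.commute)
    then have "X / ennreal ?D \<le> liminf ?H"
      by (intro Liminf_bounded) (auto simp: eventually_sequentially)
    then have "ennreal ?D * (X / ennreal ?D) \<le> ennreal ?D * liminf ?H" by (intro mult_left_mono) auto
    moreover have "ennreal ?D * (X / ennreal ?D) = X"
      using D by (simp add: ennreal_times_divide ennreal_mult_divide_eq mult.commute)
    ultimately show ?thesis by (simp add: X_def)
  qed
  then show ?thesis
    unfolding frac_maximal_def s(1)[symmetric] epowr_SUP[OF \<open>0 < q\<close>] by (intro SUP_least) auto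
qed

text \<open>Each cell lies in a closed cube of the same measure, so the weight condition passes from
  cubes to cells without loss.\<close>

lemma grid_frac_maxfun_bound:
  fixes v :: "real ^ 'n \<Rightarrow> real" and F :: "real ^ 'n \<Rightarrow> ennreal"
  assumes [measurable]: "v \<in> borel_measurable lebesgue" "F \<in> borel_measurable lebesgue"
    and v: "\<And>x. 0 < v x"
    and p: "1 < p" "p < q" and p': "1 / p + 1 / p' = 1" "0 < p'" and s: "s = 1 / q + 1 / p'"
    and "0 \<le> K" "0 < L"
    and Ap: "\<And>Q. Q \<in> cubes \<Longrightarrow> (\<integral>\<^sup>+y\<in>Q. ennreal (v y powr q) \<partial>lebesgue)
       * epowr (\<integral>\<^sup>+y\<in>Q. ennreal (v y powr - p') \<partial>lebesgue) (q / p')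
       \<le> ennreal K * epowr (emeasure lebesgue Q) (q * s)"
    and fin: "(\<integral>\<^sup>+x. epowr (F x) p * ennreal (v x powr p) \<partial>lebesgue) \<noteq> top"
  shows "(\<integral>\<^sup>+x. epowr (grid_frac_maxfun L t s F x) q * ennreal (v x powr q) \<partial>lebesgue)
    \<le> ennreal (frac_const p q K) * epowr (\<integral>\<^sup>+x. epowr (F x) p * ennreal (v x powr p) \<partial>lebesgue) (q / p)"
proof (rule refining_partition.frac_maxfun_bound[OF refining_partition_grid[OF \<open>0 < L\<close>] _ _ v p p'(1) s _ _ \<open>0 \<le> K\<close> _ fin])
  fix j and x :: "real ^ 'n"
  let ?C = "grid_cell L t j x"
  obtain a where a: "?C \<subseteq> cbox a (a + (\<chi> i. L / 2 ^ j))"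
    "emeasure lebesgue ?C = ennreal ((L / 2 ^ j) ^ CARD('n))"
    using grid_cell_in_cube[OF \<open>0 < L\<close>] by blast
  let ?Q = "cbox a (a + (\<chi> i. L / 2 ^ j))"
  have L: "0 < L / 2 ^ j" using \<open>0 < L\<close> by simp
  then have Q: "?Q \<in> cubes" unfolding cubes_def by blast
  have eq: "emeasure lebesgue ?Q = emeasure lebesgue ?C"
    unfolding a lebesgue_cube(1)[OF L] ..
  show "emeasure lebesgue ?C \<noteq> 0" "emeasure lebesgue ?C \<noteq> top"
    unfolding a using L by auto
  have mono: "(\<integral>\<^sup>+y\<in>?C. g y \<partial>lebesgue) \<le> (\<integral>\<^sup>+y\<in>?Q. g y \<partial>lebesgue)" for g
    using a by (intro nn_integral_mono) (auto split: split_indicator)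
  have "(\<integral>\<^sup>+y\<in>?C. ennreal (v y powr q) \<partial>lebesgue) * epowr (\<integral>\<^sup>+y\<in>?C. ennreal (v y powr - p') \<partial>lebesgue) (q / p')
      \<le> (\<integral>\<^sup>+y\<in>?Q. ennreal (v y powr q) \<partial>lebesgue) * epowr (\<integral>\<^sup>+y\<in>?Q. ennreal (v y powr - p') \<partial>lebesgue) (q / p')"
    using p p' by (intro mult_mono epowr_mono mono) auto
  also have "\<dots> \<le> ennreal K * epowr (emeasure lebesgue ?Q) (q * s)" by (rule Ap[OF Q])
  finally show "(\<integral>\<^sup>+y\<in>?C. ennreal (v y powr q) \<partial>lebesgue) * epowr (\<integral>\<^sup>+y\<in>?C. ennreal (v y powr - p') \<partial>lebesgue) (q / p')
     \<le> ennreal K * epowr (emeasure lebesgue ?C) (q * s)" unfolding eq .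
qed measurable

text \<open>Substituting x = A y moves the matrix from the maximal function to the weight, where w(A
  y) is at most c w(y). The bounds on the grids of side 2^N are uniform in N, so Fatou's lemma
  carries them to the liminf.\<close>

lemma frac_maximal_mat_bounded:
  fixes A :: "real ^ 'n ^ 'n" and w :: "real ^ 'n \<Rightarrow> real"
  assumes A: "invertible A" and w: "weight w" and p: "1 < p" "p < q"
    and s: "1 - \<alpha> / real CARD('n) = 1 / q + 1 / conj_exp p"
    and fin: "Apq_const (mat 1) p q w < \<infinity>"
    and c: "0 < c" "AE x in lebesgue. w (A *v x) \<le> c * w x"
  shows "bounded_weighted (frac_maximal_mat \<alpha> (matrix_inv A)) p q w"
proof -
  let ?B = "matrix_inv A"
  note B = invertible_matrix_inv[OF A]
  define p' where "p' = conj_exp p"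
  have p': "1 / p + 1 / p' = 1" "0 < p'" using conj_exp[OF p(1)] by (auto simp: p'_def)
  have q: "0 < q" using p by simp
  define s' where "s' = 1 / q + 1 / p'"
  have s': "s' = 1 - \<alpha> / real CARD('n)" "0 < s'" using p' q s by (auto simp: s'_def p'_def[symmetric] add_pos_pos)
  have [measurable]: "w \<in> borel_measurable lebesgue" and pos: "AE x in lebesgue. 0 < w x"
    using w by (auto simp: weight_def)
  \<comment> \<open>The grid estimate asks for positivity at every point; a change on a null set
    leaves averages and integrals alone.\<close>
  define v where "v x = (if 0 < w x then w x else 1)" for x
  have v_meas [measurable]: "v \<in> borel_measurable lebesgue" unfolding v_def[abs_def] by measurable
  have v: "0 < v x" for x by (simp add: v_def)
  have v_w: "AE x in lebesgue. v x = w x" using pos by eventually_elim (simp add: v_def)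
  have vA_meas [measurable]: "(\<lambda>x. v (A *v x)) \<in> borel_measurable lebesgue"
    by (rule measurable_compose[OF measurable_matrix_lebesgue[OF A] v_meas])
  have vA: "AE x in lebesgue. v (A *v x) \<le> c * v x"
    using AE_matrix_lebesgue[OF A v_w] v_w c(2) by eventually_elim simp
  obtain k where k: "0 \<le> k" "Apq_const (mat 1) p q w = ennreal k"
    using fin by (cases "Apq_const (mat 1) p q w") auto
  define K where "K = k powr q"
  have K: "0 \<le> K" by (simp add: K_def)
  have Ap: "(\<integral>\<^sup>+y\<in>Q. ennreal (v y powr q) \<partial>lebesgue) * epowr (\<integral>\<^sup>+y\<in>Q. ennreal (v y powr - p') \<partial>lebesgue) (q / p')
       \<le> ennreal K * epowr (emeasure lebesgue Q) (q * s')" if Q: "Q \<in> cubes" for Q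
  proof -
    obtain m where m: "0 < m" "emeasure lebesgue Q = ennreal m" using cubes_measure[OF Q] by metis
    have "avg_norm q Q v * avg_norm p' Q (\<lambda>x. inverse (v x))
       = avg_norm q Q (\<lambda>x. w (mat 1 *v x)) * avg_norm p' Q (\<lambda>x. inverse (w x))"
      using v_w by (intro arg_cong2[where f = "(*)"] avg_norm_cong_AE) auto
    also have "\<dots> \<le> ennreal k"
      unfolding k(2)[symmetric] Apq_const_def p'_def by (rule SUP_upper[OF Q])
    finally have "(\<integral>\<^sup>+y\<in>Q. ennreal (\<bar>v y\<bar> powr q) \<partial>lebesgue) *
        epowr (\<integral>\<^sup>+y\<in>Q. ennreal (\<bar>inverse (v y)\<bar> powr p') \<partial>lebesgue) (q / p')
       \<le> ennreal K * epowr (emeasure lebesgue Q) (q * s')"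
      unfolding K_def s'_def by (rule avg_norm_mult_le_iff[OF m(2,1) q p'(2) k(1), THEN iffD1])
    moreover have "\<bar>v y\<bar> = v y" "\<bar>inverse (v y)\<bar> powr p' = v y powr - p'" for y
      using v[of y] by (auto simp: powr_minus inverse_powr)
    ultimately show ?thesis by simp
  qed
  obtain CB where CB: "0 < CB" and subst: "\<And>f. f \<in> borel_measurable lebesgue \<Longrightarrow>
      (\<integral>\<^sup>+x. f (?B *v x) \<partial>lebesgue) \<le> ennreal CB * (\<integral>\<^sup>+x. f x \<partial>lebesgue)"
    using nn_integral_matrix_le[OF B] by metis
  \<comment> \<open>\<open>D\<close> is the cost of enlarging cubes to cells, \<open>M\<close>
    accounts for the 2^n shifted grids and the bound on each, \<open>CB\<close> comes from the
    change of variables.\<close>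
  define D where "D = ((6 ^ CARD('n)) powr s') powr q"
  define M where "M = real CARD('n set) * frac_const p q K"
  define E where "E = CB * (D * c powr q * M)"
  have fc: "0 \<le> frac_const p q K"
    using p q by (intro frac_const_nonneg) auto
  have E0: "0 \<le> E" "0 \<le> D" "0 \<le> M" using CB fc by (auto simp: E_def D_def M_def)
  have "wnorm q w (frac_maximal_mat \<alpha> ?B f) \<le> ennreal (E powr (1 / q)) * wnorm p w (\<lambda>x. ennreal \<bar>f x\<bar>)"
    if f: "f \<in> weighted_Lp p w" for f
  proof -
    have [measurable]: "f \<in> borel_measurable lebesgue" using f by (simp add: weighted_Lp_def)
    let ?F = "\<lambda>x. ennreal \<bar>f x\<bar>"
    define G where "G = (\<integral>\<^sup>+x. epowr (?F x) p * ennreal (w x powr p) \<partial>lebesgue)"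
    have wn: "wnorm p w ?F = epowr G (1 / p)" by (simp add: wnorm_def G_def)
    have G_top: "G \<noteq> top" using f by (auto simp: weighted_Lp_def wn)
    have G_v: "(\<integral>\<^sup>+x. epowr (?F x) p * ennreal (v x powr p) \<partial>lebesgue) = G"
      unfolding G_def using v_w by (intro nn_integral_cong_AE) auto
    define H where "H N x = (\<Sum>I\<in>UNIV. epowr (grid_frac_maxfun (2 ^ N) (\<chi> i. if i \<in> I then 2 ^ N / 3 else 0) s' ?F x) q)"
      for N x
    have fm_meas [measurable]: "grid_frac_maxfun (2 ^ N) t s' ?F \<in> borel_measurable lebesgue" for N t
      by (rule refining_partition.measurable_frac_maxfun[OF refining_partition_grid]) simp
    have [measurable]: "H N \<in> borel_measurable lebesgue" for N
      unfolding H_def[abs_def] by measurable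
    have H_le: "(\<integral>\<^sup>+x. H N x * ennreal (v x powr q) \<partial>lebesgue) \<le> ennreal M * epowr G (q / p)" for N
    proof -
      have "(\<integral>\<^sup>+x. H N x * ennreal (v x powr q) \<partial>lebesgue) = (\<Sum>I\<in>UNIV. \<integral>\<^sup>+x.
          epowr (grid_frac_maxfun (2 ^ N) (\<chi> i. if i \<in> I then 2 ^ N / 3 else 0) s' ?F x) q * ennreal (v x powr q) \<partial>lebesgue)"
        unfolding H_def sum_distrib_right by (intro nn_integral_sum) measurable
      also have "\<dots> \<le> (\<Sum>I\<in>(UNIV :: 'n set set). ennreal (frac_const p q K) * epowr G (q / p))"
        unfolding G_v[symmetric] using G_top G_v Ap
        by (intro sum_mono grid_frac_maxfun_bound[OF _ _ v p p' s'_def K]) auto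
      also have "\<dots> = ennreal M * epowr G (q / p)"
        using fc by (simp add: M_def ennreal_mult ennreal_of_nat_eq_real_of_nat mult.assoc)
      finally show ?thesis .
    qed
    \<comment> \<open>Substitution is applied to this measurable majorant, not to the maximal
      function itself; at y = A^(-1) x its last factor is v(x)^q.\<close>
    let ?g = "\<lambda>y. ennreal D * liminf (\<lambda>N. H N y) * ennreal (v (A *v y) powr q)"
    have "(\<integral>\<^sup>+x. epowr (frac_maximal_mat \<alpha> ?B f x) q * ennreal (w x powr q) \<partial>lebesgue)
        = (\<integral>\<^sup>+x. epowr (frac_maximal_mat \<alpha> ?B f x) q * ennreal (v x powr q) \<partial>lebesgue)"
      using v_w by (intro nn_integral_cong_AE) auto
    also have "\<dots> \<le> (\<integral>\<^sup>+x. ?g (?B *v x) \<partial>lebesgue)"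
      unfolding frac_maximal_mat_def matrix_inv_mult[OF A] D_def H_def
      by (intro nn_integral_mono mult_right_mono frac_maximal_le_liminf[OF s' q]) auto
    also have "\<dots> \<le> ennreal CB * (\<integral>\<^sup>+y. ?g y \<partial>lebesgue)"
      by (intro subst) measurable
    also have "(\<integral>\<^sup>+y. ?g y \<partial>lebesgue) \<le> (\<integral>\<^sup>+y. ennreal (D * c powr q) * (ennreal (v y powr q) * liminf (\<lambda>N. H N y)) \<partial>lebesgue)"
    proof (rule nn_integral_mono_AE)
      show "AE y in lebesgue. ?g y \<le> ennreal (D * c powr q) * (ennreal (v y powr q) * liminf (\<lambda>N. H N y))"
        using vA
      proof eventually_elim
        case (elim y)
        have "v (A *v y) powr q \<le> c powr q * v y powr q"
          using powr_mono2[OF _ _ elim, of q] q v[of "A *v y"] v[of y] c(1) by (simp add: powr_mult)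
        then have "ennreal (v (A *v y) powr q) \<le> ennreal (c powr q) * ennreal (v y powr q)"
          by (simp add: ennreal_leI flip: ennreal_mult)
        then have "?g y \<le> ennreal D * liminf (\<lambda>N. H N y) * (ennreal (c powr q) * ennreal (v y powr q))"
          by (intro mult_left_mono) auto
        also have "\<dots> = ennreal (D * c powr q) * (ennreal (v y powr q) * liminf (\<lambda>N. H N y))"
          using E0 by (simp add: ennreal_mult mult_ac)
        finally show ?case .
      qed
    qed
    also have "\<dots> = ennreal (D * c powr q) * (\<integral>\<^sup>+y. ennreal (v y powr q) * liminf (\<lambda>N. H N y) \<partial>lebesgue)"
      by (intro nn_integral_cmult) measurable
    also have "(\<integral>\<^sup>+y. ennreal (v y powr q) * liminf (\<lambda>N. H N y) \<partial>lebesgue)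
        = (\<integral>\<^sup>+y. liminf (\<lambda>N. H N y) \<partial>density lebesgue (\<lambda>y. ennreal (v y powr q)))"
      by (subst nn_integral_density) auto
    also have "\<dots> \<le> liminf (\<lambda>N. \<integral>\<^sup>+y. H N y \<partial>density lebesgue (\<lambda>y. ennreal (v y powr q)))"
      by (intro nn_integral_liminf) measurable
    also have "\<dots> \<le> liminf (\<lambda>N::nat. ennreal M * epowr G (q / p))"
      using H_le by (intro Liminf_mono always_eventually allI) (simp add: nn_integral_density mult.commute)
    also have "\<dots> = ennreal M * epowr G (q / p)"
      by (rule Liminf_const) simp
    finally have "(\<integral>\<^sup>+x. epowr (frac_maximal_mat \<alpha> ?B f x) q * ennreal (w x powr q) \<partial>lebesgue)
        \<le> ennreal CB * (ennreal (D * c powr q) * (ennreal M * epowr G (q / p)))"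
      by (simp add: mult_left_mono)
    also have "\<dots> = ennreal E * epowr G (q / p)"
      using E0 CB by (simp add: E_def ennreal_mult mult_ac)
    finally have "wnorm q w (frac_maximal_mat \<alpha> ?B f) \<le> epowr (ennreal E * epowr G (q / p)) (1 / q)"
      unfolding wnorm_def using q by (intro epowr_mono) auto
    also have "\<dots> = ennreal (E powr (1 / q)) * epowr G (1 / p)"
      using E0 q by (simp add: epowr_mult epowr_epowr epowr_ennreal)
    finally show ?thesis by (simp add: wn)
  qed
  then show ?thesis unfolding bounded_weighted_def by blast
qed

section \<open>Necessity of the weight condition\<close>

lemma frac_average_le_frac_maximal_mat:
  fixes B :: "real ^ 'n ^ 'n"
  assumes "Q \<in> cubes" "B *v x \<in> Q"
  shows "(\<integral>\<^sup>+y\<in>Q. ennreal \<bar>f y\<bar> \<partial>lebesgue) / ennreal (measure lebesgue Q powr (1 - \<alpha> / real CARD('n)))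
    \<le> frac_maximal_mat \<alpha> B f x"
  unfolding frac_maximal_mat_def frac_maximal_def using assms by (intro SUP_upper) auto

text \<open>For f = \<sigma> on a set where w > 0, the relation p' p - p' = p gives f^p w^p =
  \<sigma>, so the integral of f and its p-energy are the same number and the operator inequality
  compares powers of it. Truncation makes that number finite, so that it can be cancelled.\<close>

lemma Apq_const_finite_if_bounded:
  fixes A :: "real ^ 'n ^ 'n" and w :: "real ^ 'n \<Rightarrow> real"
  assumes A: "invertible A" and w: "weight w" and p: "1 < p" and q: "0 < q"
    and s: "1 - \<alpha> / real CARD('n) = 1 / q + 1 / conj_exp p"
    and bdd: "bounded_weighted (frac_maximal_mat \<alpha> (matrix_inv A)) p q w"
  shows "Apq_const A p q w < \<infinity>"
proof -
  let ?B = "matrix_inv A"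
  note B = invertible_matrix_inv[OF A]
  define p' where "p' = conj_exp p"
  have p': "1 / p + 1 / p' = 1" "0 < p'" using conj_exp[OF p] by (auto simp: p'_def)
  have "p' * (p - 1) = p" using p by (simp add: p'_def conj_exp_def)
  then have pp': "p' * p - p' = p" by (simp add: algebra_simps)
  define s' where "s' = 1 / q + 1 / p'"
  have s': "1 - \<alpha> / real CARD('n) = s'" using s by (simp add: s'_def p'_def)
  have w_meas [measurable]: "w \<in> borel_measurable lebesgue" and pos: "AE x in lebesgue. 0 < w x"
    using w by (auto simp: weight_def)
  define \<sigma> where "\<sigma> x = \<bar>inverse (w x)\<bar> powr p'" for x
  have \<sigma>_meas [measurable]: "\<sigma> \<in> borel_measurable lebesgue" unfolding \<sigma>_def[abs_def] by measurable
  have \<sigma>0: "0 \<le> \<sigma> x" for x by (simp add: \<sigma>_def)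
  from bdd obtain C0 where "\<forall>f\<in>weighted_Lp p w.
      wnorm q w (frac_maximal_mat \<alpha> ?B f) \<le> ennreal C0 * wnorm p w (\<lambda>x. ennreal \<bar>f x\<bar>)"
    unfolding bounded_weighted_def by blast
  then obtain C where C: "0 \<le> C" and T: "\<And>f. f \<in> weighted_Lp p w \<Longrightarrow>
      wnorm q w (frac_maximal_mat \<alpha> ?B f) \<le> ennreal C * wnorm p w (\<lambda>x. ennreal \<bar>f x\<bar>)"
    by (metis ennreal_neg linear mult_zero_left ennreal_0 order_refl)
  obtain CA where CA: "0 < CA" and subst: "\<And>f. f \<in> borel_measurable lebesgue \<Longrightarrow>
      (\<integral>\<^sup>+x. f (A *v x) \<partial>lebesgue) \<le> ennreal CA * (\<integral>\<^sup>+x. f x \<partial>lebesgue)"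
    using nn_integral_matrix_le[OF A] by metis
  define k where "k = (CA * C powr q) powr (1 / q)"
  have kq: "k powr q = CA * C powr q" using CA C q by (simp add: k_def powr_powr)
  have "avg_norm q Q (\<lambda>x. w (A *v x)) * avg_norm p' Q (\<lambda>x. inverse (w x)) \<le> ennreal k" if Q: "Q \<in> cubes" for Q
  proof -
    obtain m where m: "0 < m" "emeasure lebesgue Q = ennreal m" "measure lebesgue Q = m" and Q_sets [measurable]: "Q \<in> sets lebesgue"
      using cubes_measure[OF Q] by metis
    define U where "U = (\<integral>\<^sup>+x\<in>Q. ennreal (\<bar>w (A *v x)\<bar> powr q) \<partial>lebesgue)"
    \<comment> \<open>The w^q-measure of the image of \<open>Q\<close> under \<open>A\<close>; there
      the maximal function is at least the fractional average over \<open>Q\<close>.\<close>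
    define Z where "Z = (\<integral>\<^sup>+x. ennreal (w x powr q) * indicator Q (?B *v x) \<partial>lebesgue)"
    have [measurable]: "(\<lambda>x. indicator Q (?B *v x) :: ennreal) \<in> borel_measurable lebesgue"
      by (rule measurable_compose[OF measurable_matrix_lebesgue[OF B]]) measurable
    have U_Z: "U \<le> ennreal CA * Z"
    proof -
      have "U = (\<integral>\<^sup>+x. ennreal (\<bar>w (A *v x)\<bar> powr q) * indicator Q (?B *v (A *v x)) \<partial>lebesgue)"
        by (simp add: U_def matrix_inv_mult[OF A])
      also have "\<dots> \<le> ennreal CA * (\<integral>\<^sup>+x. ennreal (\<bar>w x\<bar> powr q) * indicator Q (?B *v x) \<partial>lebesgue)"
        by (rule subst) measurable
      also have "(\<integral>\<^sup>+x. ennreal (\<bar>w x\<bar> powr q) * indicator Q (?B *v x) \<partial>lebesgue) = Z"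
        unfolding Z_def using pos by (intro nn_integral_cong_AE) auto
      finally show ?thesis .
    qed
    define E where "E N = {x \<in> Q. 0 < w x \<and> \<sigma> x \<le> real N}" for N
    have E [measurable]: "E N \<in> sets lebesgue" for N
    proof -
      have "{x \<in> space lebesgue. x \<in> Q \<and> 0 < w x \<and> \<sigma> x \<le> real N} \<in> sets lebesgue" by measurable
      then show ?thesis by (simp add: E_def)
    qed
    define S where "S N = (\<integral>\<^sup>+x\<in>E N. ennreal (\<sigma> x) \<partial>lebesgue)" for N
    have S_bound: "U * epowr (S N) (q / p') \<le> ennreal (k powr q) * epowr (emeasure lebesgue Q) (q * s')" for N
    proof -
      define f where "f x = \<sigma> x * indicator (E N) x" for x
      have f_meas [measurable]: "f \<in> borel_measurable lebesgue" unfolding f_def[abs_def] by measurable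
      have "S N \<le> (\<integral>\<^sup>+x. ennreal (real N) * indicator Q x \<partial>lebesgue)"
        unfolding S_def by (intro nn_integral_mono) (auto simp: E_def ennreal_leI split: split_indicator)
      also have "\<dots> = ennreal (real N * m)"
        using m by (simp add: nn_integral_cmult_indicator ennreal_mult del: emeasure_completion)
      finally have "S N \<noteq> top" by (auto simp: top_unique)
      then obtain S' where S': "S N = ennreal S'" "0 \<le> S'" by (cases "S N") auto
      have f_int: "(\<integral>\<^sup>+y\<in>Q. ennreal \<bar>f y\<bar> \<partial>lebesgue) = S N"
        unfolding S_def f_def by (intro nn_integral_cong) (auto simp: E_def \<sigma>0 split: split_indicator)
      have "epowr (ennreal \<bar>f x\<bar>) p * ennreal (w x powr p) = ennreal (\<sigma> x) * indicator (E N) x" for x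
      proof (cases "x \<in> E N")
        case True
        then have w0: "0 < w x" by (simp add: E_def)
        have "\<sigma> x = w x powr - p'" using w0 by (simp add: \<sigma>_def powr_minus inverse_powr)
        moreover have "(w x powr - p') powr p * w x powr p = w x powr - p'"
          using pp' by (simp add: powr_powr algebra_simps flip: powr_add)
        ultimately show ?thesis
          using True by (simp add: f_def epowr_ennreal flip: ennreal_mult)
      qed (simp add: f_def)
      then have wn: "wnorm p w (\<lambda>x. ennreal \<bar>f x\<bar>) = epowr (S N) (1 / p)"
        by (simp add: wnorm_def S_def)
      then have "f \<in> weighted_Lp p w"
        using S' p by (simp add: weighted_Lp_def epowr_ennreal)
      from T[OF this] have le: "wnorm q w (frac_maximal_mat \<alpha> ?B f) \<le> ennreal C * epowr (S N) (1 / p)"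
        unfolding wn .
      have "epowr (S N / ennreal (m powr s')) q * Z
          = (\<integral>\<^sup>+x. epowr (S N / ennreal (m powr s')) q * (ennreal (w x powr q) * indicator Q (?B *v x)) \<partial>lebesgue)"
        unfolding Z_def by (intro nn_integral_cmult[symmetric]) measurable
      also have "\<dots> \<le> (\<integral>\<^sup>+x. epowr (frac_maximal_mat \<alpha> ?B f x) q * ennreal (w x powr q) \<partial>lebesgue)"
      proof (rule nn_integral_mono)
        fix x
        show "epowr (S N / ennreal (m powr s')) q * (ennreal (w x powr q) * indicator Q (?B *v x))
           \<le> epowr (frac_maximal_mat \<alpha> ?B f x) q * ennreal (w x powr q)"
        proof (cases "?B *v x \<in> Q")
          case True
          then have "S N / ennreal (m powr s') \<le> frac_maximal_mat \<alpha> ?B f x"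
            using frac_average_le_frac_maximal_mat[OF Q, of ?B x f \<alpha>] by (simp add: f_int m s')
          with True q show ?thesis
            by (auto intro!: mult_right_mono epowr_mono)
        qed simp
      qed
      also have "\<dots> \<le> epowr (ennreal C * epowr (S N) (1 / p)) q"
        using le q epowr_le_iff[of "1 / q"] by (simp add: wnorm_def)
      also have "\<dots> = ennreal (C powr q) * epowr (S N) (q / p)"
        using C by (simp add: epowr_mult epowr_epowr epowr_ennreal)
      finally have 1: "ennreal ((S' / m powr s') powr q) * Z \<le> ennreal (C powr q * S' powr (q / p))"
        using S' m by (simp add: divide_ennreal epowr_ennreal ennreal_mult)
      show ?thesis
      proof (cases "S' = 0")
        case True
        then show ?thesis by (simp add: S')
      next
        case False
        with S' have S0: "0 < S'" by simp
        have "q * (1 / p + 1 / p') = q / p + q / p'" by (simp add: distrib_left)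
        then have "q = q / p + q / p'" unfolding p'(1) by simp
        then have Sq: "S' powr q = S' powr (q / p) * S' powr (q / p')"
          by (metis powr_add)
        \<comment> \<open>A common factor of both sides. Since q = q/p + q/p', dividing by it leaves
          S'^(q/p'), the power in the weight condition.\<close>
        define d where "d = S' powr (q / p) / m powr (q * s')"
        have d: "0 < d" using S0 m by (simp add: d_def)
        have "(S' / m powr s') powr q = d * S' powr (q / p')"
          using S0 m by (simp add: d_def powr_divide powr_powr Sq mult.commute)
        moreover have "C powr q * S' powr (q / p) = d * (C powr q * m powr (q * s'))"
          using S0 m by (simp add: d_def)
        ultimately have "ennreal (d * S' powr (q / p')) * Z \<le> ennreal (d * (C powr q * m powr (q * s')))"
          using 1 by metis
        then have "ennreal d * (ennreal (S' powr (q / p')) * Z) \<le> ennreal d * ennreal (C powr q * m powr (q * s'))"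
          using d by (subst (asm) (1 2) ennreal_mult') (auto simp: mult.assoc)
        then have 2: "ennreal (S' powr (q / p')) * Z \<le> ennreal (C powr q * m powr (q * s'))"
          using d by (subst (asm) ennreal_mult_le_mult_iff) auto
        have "U * epowr (S N) (q / p') \<le> ennreal CA * Z * ennreal (S' powr (q / p'))"
          using U_Z S' by (simp add: epowr_ennreal mult_right_mono)
        also have "\<dots> = ennreal CA * (ennreal (S' powr (q / p')) * Z)" by (simp add: mult_ac)
        also have "\<dots> \<le> ennreal CA * ennreal (C powr q * m powr (q * s'))"
          using 2 by (intro mult_left_mono) auto
        also have "\<dots> = ennreal (k powr q) * epowr (emeasure lebesgue Q) (q * s')"
          unfolding m(2) kq using m CA by (simp add: epowr_ennreal mult.assoc flip: ennreal_mult)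
        finally show ?thesis .
      qed
    qed
    \<comment> \<open>The truncation is removed by monotone convergence: almost every point of
      \<open>Q\<close> lies in all but finitely many \<open>E N\<close>.\<close>
    have "(\<integral>\<^sup>+x\<in>Q. ennreal (\<bar>inverse (w x)\<bar> powr p') \<partial>lebesgue) = (\<integral>\<^sup>+x. (SUP N. ennreal (\<sigma> x) * indicator (E N) x) \<partial>lebesgue)"
    proof (rule nn_integral_cong_AE)
      show "AE x in lebesgue. ennreal (\<bar>inverse (w x)\<bar> powr p') * indicator Q x = (SUP N. ennreal (\<sigma> x) * indicator (E N) x)"
        using pos
      proof eventually_elim
        case (elim x)
        show ?case
        proof (cases "x \<in> Q")
          case True
          obtain N where "\<sigma> x \<le> real N" using real_arch_simple by blast
          with True elim have "x \<in> E N" by (simp add: E_def)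
          then have "(SUP N. ennreal (\<sigma> x) * indicator (E N) x) = ennreal (\<sigma> x)"
            by (intro antisym SUP_least SUP_upper2[of N]) (auto split: split_indicator)
          with True show ?thesis by (simp add: \<sigma>_def)
        qed (simp add: E_def)
      qed
    qed
    also have "\<dots> = (SUP N. S N)"
      unfolding S_def
    proof (rule nn_integral_monotone_convergence_SUP)
      show "incseq (\<lambda>N x. ennreal (\<sigma> x) * indicator (E N) x)"
        by (auto simp: incseq_def le_fun_def E_def split: split_indicator)
    qed measurable
    finally have "U * epowr (\<integral>\<^sup>+x\<in>Q. ennreal (\<bar>inverse (w x)\<bar> powr p') \<partial>lebesgue) (q / p')
        = (SUP N. U * epowr (S N) (q / p'))"
      using q p' by (simp add: epowr_SUP SUP_mult_left_ennreal)
    also have "\<dots> \<le> ennreal (k powr q) * epowr (emeasure lebesgue Q) (q * s')"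
      by (intro SUP_least S_bound)
    finally show ?thesis
      unfolding U_def s'_def by (rule avg_norm_mult_le_iff[OF m(2,1) q p'(2), THEN iffD2, rotated]) (simp add: k_def)
  qed
  then have "Apq_const A p q w \<le> ennreal k"
    unfolding Apq_const_def p'_def[symmetric] by (intro SUP_least)
  then show ?thesis by (auto intro: le_less_trans)
qed

theorem theorem1p11:
  fixes A :: "real ^ 'n ^ 'n" and \<alpha> p q :: real and k :: nat
  assumes "0 < \<alpha>" and "\<alpha> < real CARD('n)"
    and "1 < p" and "0 < q" and "1 / q = 1 / p - \<alpha> / real CARD('n)"
    and "invertible A" and "1 \<le> k" and "matrix_power A k = mat 1"
  shows "Apq_class_mat A p q =
           {w \<in> Apq_class p q. \<exists>C>0. AE x in lebesgue. w (A *v x) \<le> C * w x} \<and>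
         (\<forall>w. weight w \<longrightarrow>
           (w \<in> Apq_class_mat A p q \<longleftrightarrow>
            bounded_weighted (frac_maximal_mat \<alpha> (matrix_inv A)) p q w))"
proof (intro conjI allI impI iffI)
  note A = assms(6-8) and p = assms(3) and q = assms(4)
  have "1 / q < 1 / p" using assms by simp
  then have pq: "p < q" using p q by (simp add: field_simps)
  \<comment> \<open>The volume exponent of M_\<alpha> on the left, that of the weight condition on
    the right: this is where the scaling relation between p, q and \<alpha> enters.\<close>
  have s: "1 - \<alpha> / real CARD('n) = 1 / q + 1 / conj_exp p"
    using conj_exp(1)[OF p] assms(5) by simp
  show eq: "Apq_class_mat A p q = {w \<in> Apq_class p q. \<exists>C>0. AE x in lebesgue. w (A *v x) \<le> C * w x}"
    by (rule Apq_class_mat_eq[OF A p q])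
  fix w :: "real ^ 'n \<Rightarrow> real" assume w: "weight w"
  show "bounded_weighted (frac_maximal_mat \<alpha> (matrix_inv A)) p q w" if "w \<in> Apq_class_mat A p q"
  proof -
    from that obtain c where "w \<in> Apq_class p q" "0 < c" "AE x in lebesgue. w (A *v x) \<le> c * w x"
      unfolding eq by blast
    then show ?thesis
      by (intro frac_maximal_mat_bounded[OF A(1) w p pq s]) (auto simp: Apq_class_def Apq_class_mat_def)
  qed
  show "w \<in> Apq_class_mat A p q" if "bounded_weighted (frac_maximal_mat \<alpha> (matrix_inv A)) p q w"
    using Apq_const_finite_if_bounded[OF A(1) w p q s that] w by (simp add: Apq_class_mat_def)
qed

end
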